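(* Let $\Sigma$ be a finite alphabet. There are lattice isomorphisms (all lattices ordered by inclusion): (1) between local varieties of regular languages over $\Sigma$ (sets of regular languages over $\Sigma$ containing $\emptyset$ and closed under the boolean operations union, intersection, complement, and under left and right derivatives) and local pseudovarieties of $\Sigma$-generated finite monoids; (2) between local lattice varieties of regular languages over $\Sigma$ (sets of regular languages over $\Sigma$ containing $\emptyset$ and $\Sigma^*$ and closed under union, intersection and left and right derivatives) and local pseudovarieties of $\Sigma$-generated finite ordered monoids; (3) between local semilattice varieties of regular languages over $\Sigma$ (sets of regular languages over $\Sigma$ containing $\emptyset$ and closed under union and left and right derivatives) and local pseudovarieties of $\Sigma$-generated finite idempotent semirings; (4) between local linear varieties of regular languages over $\Sigma$ (sets of regular languages over $\Sigma$ containing $\emptyset$ and closed under symmetric difference and left and right derivatives) and local pseudovarieties of $\Sigma$-generated finite $\mathbb{Z}_2$-algebras.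
   Context: The derivatives of $L\subseteq\Sigma^*$ by $w\in\Sigma^*$ are $w^{-1}L=\{u: wu\in L\}$ (left) and $Lw^{-1}=\{u: uw\in L\}$ (right). Let $\mathcal{D}$ be, in cases (1)–(4) respectively: sets; posets with monotone maps; join-semilattices with $0$ (morphisms preserving $\vee$ and $0$); vector spaces over the two-element field $\mathbb{Z}_2$. A $\mathcal{D}$-monoid is an object $A$ of $\mathcal{D}$ with a monoid structure whose multiplication $\circ:A\times A\to A$ is such that all maps $a\circ-$ and $-\circ a$ are $\mathcal{D}$-morphisms; morphisms are $\mathcal{D}$-morphisms that are also monoid morphisms (preserving the unit). These are, respectively, monoids, ordered monoids, idempotent semirings (with $0$ and $1$), and (unital associative) $\mathbb{Z}_2$-algebras. The free $\mathcal{D}$-monoid $F_\Sigma$ on $\Sigma$ is, respectively: $\Sigma^*$; $\Sigma^*$ discretely ordered; the finite languages over $\Sigma$ with union and concatenation; the finite languages over $\Sigma$ with symmetric difference and $\mathbb{Z}_2$-weighted concatenation (the product of $L$ and $L'$ consists of all words having an odd number of factorizations $uu'$ with $u\in L$, $u'\in L'$). A $\Sigma$-generated $\mathcal{D}$-monoid is (up to isomorphism) a surjective $\mathcal{D}$-monoid morphism $e:F_\Sigma\twoheadrightarrow A$. They are ordered by $e\le e'$ iff $e=h\cdot e'$ for some $\mathcal{D}$-monoid morphism $h$. The finite ones form a join-semilattice; the join of $e_1,\dots,e_n$ is their subdirect product, i.e. the image of $\langle e_1,\dots,e_n\rangle:F_\Sigma\to\prod A_i$ (with order inherited from the product in case (2)).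 A local pseudovariety is a set of finite $\Sigma$-generated $\mathcal{D}$-monoids closed under subdirect products and quotients, i.e. an ideal (down-set closed under finite joins, including the empty join) of this join-semilattice. *)

theory Defs
  imports "HOL-Algebra.Module" "HOL-Library.Z2"
begin

section \<open>Languages\<close>

text \<open>The alphabet is a set \<open>\<Sigma>\<close>, so \<open>lists \<Sigma>\<close> is the set of words over it. A state set of a finite
  automaton may be taken to be a set of natural numbers.\<close>

definition regular :: "'a set \<Rightarrow> 'a list set \<Rightarrow> bool" where
  "regular \<Sigma> L \<longleftrightarrow>
     (\<exists>(Q :: nat set) \<delta> q\<^sub>0 F. finite Q \<and> q\<^sub>0 \<in> Q \<and> F \<subseteq> Q \<and> (\<forall>q\<in>Q. \<forall>a\<in>\<Sigma>. \<delta> q a \<in> Q) \<and>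
        L = {w \<in> lists \<Sigma>. foldl \<delta> q\<^sub>0 w \<in> F})"

definition left_derivative :: "'a list \<Rightarrow> 'a list set \<Rightarrow> 'a list set" where
  "left_derivative w L = {u. w @ u \<in> L}"

definition right_derivative :: "'a list set \<Rightarrow> 'a list \<Rightarrow> 'a list set" where
  "right_derivative L w = {u. u @ w \<in> L}"

definition derivative_closed :: "'a set \<Rightarrow> 'a list set set \<Rightarrow> bool" where
  "derivative_closed \<Sigma> V \<longleftrightarrow>
     (\<forall>L\<in>V. \<forall>w\<in>lists \<Sigma>. left_derivative w L \<in> V \<and> right_derivative L w \<in> V)"

definition local_variety :: "'a set \<Rightarrow> 'a list set set \<Rightarrow> bool" where
  "local_variety \<Sigma> V \<longleftrightarrow>
     (\<forall>L\<in>V. regular \<Sigma> L) \<and> {} \<in> V \<and>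
     (\<forall>K\<in>V. \<forall>L\<in>V. K \<union> L \<in> V) \<and> (\<forall>K\<in>V. \<forall>L\<in>V. K \<inter> L \<in> V) \<and>
     (\<forall>L\<in>V. lists \<Sigma> - L \<in> V) \<and> derivative_closed \<Sigma> V"

definition local_lattice_variety :: "'a set \<Rightarrow> 'a list set set \<Rightarrow> bool" where
  "local_lattice_variety \<Sigma> V \<longleftrightarrow>
     (\<forall>L\<in>V. regular \<Sigma> L) \<and> {} \<in> V \<and> lists \<Sigma> \<in> V \<and>
     (\<forall>K\<in>V. \<forall>L\<in>V. K \<union> L \<in> V) \<and> (\<forall>K\<in>V. \<forall>L\<in>V. K \<inter> L \<in> V) \<and>
     derivative_closed \<Sigma> V"

definition local_semilattice_variety :: "'a set \<Rightarrow> 'a list set set \<Rightarrow> bool" where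
  "local_semilattice_variety \<Sigma> V \<longleftrightarrow>
     (\<forall>L\<in>V. regular \<Sigma> L) \<and> {} \<in> V \<and>
     (\<forall>K\<in>V. \<forall>L\<in>V. K \<union> L \<in> V) \<and> derivative_closed \<Sigma> V"

definition local_linear_variety :: "'a set \<Rightarrow> 'a list set set \<Rightarrow> bool" where
  "local_linear_variety \<Sigma> V \<longleftrightarrow>
     (\<forall>L\<in>V. regular \<Sigma> L) \<and> {} \<in> V \<and>
     (\<forall>K\<in>V. \<forall>L\<in>V. sym_diff K L \<in> V) \<and> derivative_closed \<Sigma> V"


section \<open>\<open>\<D>\<close>-monoids\<close>

datatype dcat = Sets | Posets | JoinSemilattices | VectorSpacesZ2

text \<open>One record type serves all four categories. Each category uses only its own fields
  (\<open>order_rel\<close> for posets, \<open>\<oplus>\<close> and \<open>\<zero>\<close> as join and bottom for semilattices, \<open>\<oplus>\<close>, \<open>\<zero>\<close> and \<open>\<odot>\<close>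
  for vector spaces); the other fields are ignored by all notions below.\<close>

record 'b dstruct = "(bit, 'b) module" +
  order_rel :: "('b \<times> 'b) set"

definition Z2 :: "bit ring" where
  "Z2 = \<lparr>carrier = UNIV, mult = (*), one = 1, zero = 0, add = (+)\<rparr>"

primrec dobject :: "dcat \<Rightarrow> 'b dstruct \<Rightarrow> bool" where
  "dobject Sets A \<longleftrightarrow> True"
| "dobject Posets A \<longleftrightarrow> partial_order_on (carrier A) (order_rel A)"
| "dobject JoinSemilattices A \<longleftrightarrow> abelian_monoid A \<and> (\<forall>x\<in>carrier A. x \<oplus>\<^bsub>A\<^esub> x = x)"
| "dobject VectorSpacesZ2 A \<longleftrightarrow> module Z2 A"

primrec preserves_structure :: "dcat \<Rightarrow> 'b dstruct \<Rightarrow> 'c dstruct \<Rightarrow> ('b \<Rightarrow> 'c) \<Rightarrow> bool" where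
  "preserves_structure Sets A B h \<longleftrightarrow> True"
| "preserves_structure Posets A B h \<longleftrightarrow> (\<forall>(x, y)\<in>order_rel A. (h x, h y) \<in> order_rel B)"
| "preserves_structure JoinSemilattices A B h \<longleftrightarrow>
     h \<zero>\<^bsub>A\<^esub> = \<zero>\<^bsub>B\<^esub> \<and> (\<forall>x\<in>carrier A. \<forall>y\<in>carrier A. h (x \<oplus>\<^bsub>A\<^esub> y) = h x \<oplus>\<^bsub>B\<^esub> h y)"
| "preserves_structure VectorSpacesZ2 A B h \<longleftrightarrow>
     (\<forall>x\<in>carrier A. \<forall>y\<in>carrier A. h (x \<oplus>\<^bsub>A\<^esub> y) = h x \<oplus>\<^bsub>B\<^esub> h y) \<and>
     (\<forall>c. \<forall>x\<in>carrier A. h (c \<odot>\<^bsub>A\<^esub> x) = c \<odot>\<^bsub>B\<^esub> h x)"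

definition dmorphism :: "dcat \<Rightarrow> 'b dstruct \<Rightarrow> 'c dstruct \<Rightarrow> ('b \<Rightarrow> 'c) \<Rightarrow> bool" where
  "dmorphism D A B h \<longleftrightarrow> h \<in> carrier A \<rightarrow> carrier B \<and> preserves_structure D A B h"

definition dmonoid :: "dcat \<Rightarrow> 'b dstruct \<Rightarrow> bool" where
  "dmonoid D A \<longleftrightarrow> dobject D A \<and> Group.monoid A \<and>
     (\<forall>a\<in>carrier A. dmorphism D A A (\<lambda>x. a \<otimes>\<^bsub>A\<^esub> x) \<and> dmorphism D A A (\<lambda>x. x \<otimes>\<^bsub>A\<^esub> a))"

definition dmonoid_morphism :: "dcat \<Rightarrow> 'b dstruct \<Rightarrow> 'c dstruct \<Rightarrow> ('b \<Rightarrow> 'c) \<Rightarrow> bool" where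
  "dmonoid_morphism D A B h \<longleftrightarrow> dmorphism D A B h \<and> h \<in> hom A B \<and> h \<one>\<^bsub>A\<^esub> = \<one>\<^bsub>B\<^esub>"


section \<open>Free \<open>\<D>\<close>-monoids\<close>

text \<open>\<open>\<Sigma>*\<close> with the discrete order, free both for sets and for posets.\<close>

definition free_monoid :: "'a set \<Rightarrow> 'a list dstruct" where
  "free_monoid \<Sigma> =
     \<lparr>carrier = lists \<Sigma>, mult = (@), one = [], zero = undefined, add = undefined,
      smult = undefined, order_rel = Id_on (lists \<Sigma>)\<rparr>"

definition free_semiring :: "'a set \<Rightarrow> 'a list set dstruct" where
  "free_semiring \<Sigma> =
     \<lparr>carrier = {L. finite L \<and> L \<subseteq> lists \<Sigma>}, mult = (\<lambda>K L. {u @ v | u v. u \<in> K \<and> v \<in> L}),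
      one = {[]}, zero = {}, add = (\<union>), smult = undefined, order_rel = undefined\<rparr>"

definition free_Z2_algebra :: "'a set \<Rightarrow> 'a list set dstruct" where
  "free_Z2_algebra \<Sigma> =
     \<lparr>carrier = {L. finite L \<and> L \<subseteq> lists \<Sigma>},
      mult = (\<lambda>K L. {w. odd (card {(u, v). u \<in> K \<and> v \<in> L \<and> w = u @ v})}),
      one = {[]}, zero = {}, add = sym_diff, smult = (\<lambda>c L. if c = 1 then L else {}),
      order_rel = undefined\<rparr>"


section \<open>Generated \<open>\<D>\<close>-monoids and local pseudovarieties\<close>

text \<open>A generated \<open>\<D>\<close>-monoid is a pair \<open>(A, e)\<close> of a \<open>\<D>\<close>-monoid and a surjective morphism
  \<open>e : F \<rightarrow> A\<close> from the free \<open>\<D>\<close>-monoid \<open>F\<close>; only the values of \<open>e\<close> on \<open>carrier F\<close> matter.\<close>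

type_synonym ('f, 'b) gen = "'b dstruct \<times> ('f \<Rightarrow> 'b)"

definition generated :: "dcat \<Rightarrow> 'f dstruct \<Rightarrow> ('f, 'b) gen \<Rightarrow> bool" where
  "generated D F = (\<lambda>(A, e). dmonoid D A \<and> dmonoid_morphism D F A e \<and> e ` carrier F = carrier A)"

definition quotient_le :: "dcat \<Rightarrow> 'f dstruct \<Rightarrow> ('f, 'b) gen \<Rightarrow> ('f, 'c) gen \<Rightarrow> bool" where
  "quotient_le D F = (\<lambda>(A, e) (A', e').
     \<exists>h. dmonoid_morphism D A' A h \<and> (\<forall>x\<in>carrier F. e x = h (e' x)))"

definition isomorphic_gen :: "dcat \<Rightarrow> 'f dstruct \<Rightarrow> ('f, 'b) gen \<Rightarrow> ('f, 'c) gen \<Rightarrow> bool" where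
  "isomorphic_gen D F = (\<lambda>(A, e) (A', e').
     \<exists>h k. dmonoid_morphism D A' A h \<and> dmonoid_morphism D A A' k \<and>
       (\<forall>x\<in>carrier A. h (k x) = x) \<and> (\<forall>y\<in>carrier A'. k (h y) = y) \<and>
       (\<forall>x\<in>carrier F. e x = h (e' x)))"

text \<open>The product of finitely many structures consists of lists, with componentwise structure;
  the empty product is \<open>{[]}\<close>.\<close>

definition dproduct :: "'b dstruct list \<Rightarrow> 'b list dstruct" where
  "dproduct As =
     \<lparr>carrier = listset (map carrier As),
      mult = (\<lambda>xs ys. map (\<lambda>i. xs ! i \<otimes>\<^bsub>As ! i\<^esub> ys ! i) [0..<length As]),
      one = map one As,
      zero = map zero As,
      add = (\<lambda>xs ys. map (\<lambda>i. xs ! i \<oplus>\<^bsub>As ! i\<^esub> ys ! i) [0..<length As]),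
      smult = (\<lambda>c xs. map (\<lambda>i. c \<odot>\<^bsub>As ! i\<^esub> xs ! i) [0..<length As]),
      order_rel = {(xs, ys). xs \<in> listset (map carrier As) \<and> ys \<in> listset (map carrier As) \<and>
        (\<forall>i<length As. (xs ! i, ys ! i) \<in> order_rel (As ! i))}\<rparr>"

definition tupling :: "('f, 'b) gen list \<Rightarrow> 'f \<Rightarrow> 'b list" where
  "tupling gs x = map (\<lambda>(A, e). e x) gs"

definition subdirect_product :: "'f dstruct \<Rightarrow> ('f, 'b) gen list \<Rightarrow> ('f, 'b list) gen" where
  "subdirect_product F gs =
     (let P = dproduct (map fst gs); I = tupling gs ` carrier F
      in (P\<lparr>carrier := I, order_rel := order_rel P \<inter> I \<times> I\<rparr>, tupling gs))"

text \<open>Every finite \<open>\<D>\<close>-monoid is isomorphic to one whose carrier is a set of natural numbers. A set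
  of generated finite \<open>\<D>\<close>-monoids, taken up to isomorphism, is represented by the
  isomorphism-closed set of all its representatives with such carriers. Closure under quotients
  entails closure under isomorphism, so inclusion of the representing sets is inclusion of the
  represented sets of isomorphism classes.\<close>

definition finite_generated :: "dcat \<Rightarrow> 'f dstruct \<Rightarrow> ('f, nat) gen set" where
  "finite_generated D F = {g. generated D F g \<and> finite (carrier (fst g))}"

definition local_pseudovariety :: "dcat \<Rightarrow> 'f dstruct \<Rightarrow> ('f, nat) gen set \<Rightarrow> bool" where
  "local_pseudovariety D F P \<longleftrightarrow>
     P \<subseteq> finite_generated D F \<and>
     (\<forall>g\<in>P. \<forall>g'\<in>finite_generated D F. quotient_le D F g' g \<longrightarrow> g' \<in> P) \<and>
     (\<forall>gs\<in>lists P. \<forall>g\<in>finite_generated D F.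
        isomorphic_gen D F g (subdirect_product F gs) \<longrightarrow> g \<in> P)"


section \<open>Lattice isomorphisms\<close>

definition inclusion_order :: "('b set \<Rightarrow> bool) \<Rightarrow> 'b set gorder" where
  "inclusion_order C = \<lparr>carrier = {X. C X}, eq = (=), le = (\<subseteq>)\<rparr>"

definition lattice_isomorphism :: "'b gorder \<Rightarrow> 'c gorder \<Rightarrow> ('b \<Rightarrow> 'c) \<Rightarrow> bool" where
  "lattice_isomorphism L M f \<longleftrightarrow>
     Lattice.lattice L \<and> Lattice.lattice M \<and> bij_betw f (carrier L) (carrier M) \<and>
     (\<forall>x\<in>carrier L. \<forall>y\<in>carrier L.
        f (x \<squnion>\<^bsub>L\<^esub> y) = f x \<squnion>\<^bsub>M\<^esub> f y \<and> f (x \<sqinter>\<^bsub>L\<^esub> y) = f x \<sqinter>\<^bsub>M\<^esub> f y)"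

end

theory Submission
  imports Defs
begin

text \<open>Let \<open>F\<close> be the free \<open>\<D>\<close>-monoid. A generated \<open>\<D>\<close>-monoid \<open>e : F \<rightarrow> A\<close> is determined by its
  kernel, a congruence on \<open>F\<close> (a compatible preorder in the ordered case), and \<open>e \<le> e'\<close> means that the
  kernel of \<open>e\<close> contains that of \<open>e'\<close>. Every language extends uniquely to a \<open>\<D>\<close>-morphism from \<open>F\<close> to
  the two-element object \<open>O\<close> of \<open>\<D>\<close>, and \<open>e\<close> recognizes the languages whose extension respects the
  kernel. Since \<open>O\<close> is a cogenerator, a congruence is recovered from the languages that respect it;
  conversely, for a finite derivative-closed set \<open>\<Delta>\<close> of languages, every language respecting the
  congruence induced by \<open>\<Delta>\<close> belongs to the closure of \<open>\<Delta>\<close> under the operations of \<open>\<D>\<close>. Hence finite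
  generated \<open>\<D>\<close>-monoids correspond to finite local varieties. A regular language has finitely many
  derivatives, so every local variety is the directed union of its finite subvarieties, and the
  correspondence extends to local varieties and ideals of finite generated \<open>\<D>\<close>-monoids.\<close>

subsection \<open>Isomorphisms of inclusion orders\<close>

text \<open>A congruence on a free semiring or algebra relates finite languages and is not
  determined by the pairs of words in it, so a language has to be evaluated on all of
  \<open>F\<close>. Derivatives, however, translate by single words only. The gap closes because
  elements of \<open>F\<close> are words or finite sets of words: the value of \<open>L\<close> on a
  product is a disjunction or a parity of values of derivatives of \<open>L\<close>, one for each
  word of the other factor. Joins of varieties would mix closure under the operations with closure
  under derivatives. They are avoided by working with inclusion alone: pseudovarieties are closed
  under intersection, and the lattice of varieties inherits its operations along an order
  isomorphism. Carriers are sets of natural numbers, but products consist of lists. A subdirect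
  product is therefore never renumbered; its kernel is realized afresh on natural numbers, and
  equality of kernels supplies the isomorphism.\<close>

lemma inclusion_order_simps [simp]:
  "carrier (inclusion_order C) = {X. C X}"
  "(.=\<^bsub>inclusion_order C\<^esub>) = (=)"
  "(\<sqsubseteq>\<^bsub>inclusion_order C\<^esub>) = (\<subseteq>)"
  by (simp_all add: inclusion_order_def)

lemma partial_order_inclusion_order: "Order.partial_order (inclusion_order C)"
  by unfold_locales auto

lemma Upper_inclusion_order:
  "C X \<Longrightarrow> C Y \<Longrightarrow> Upper (inclusion_order C) {X, Y} = {W. C W \<and> X \<subseteq> W \<and> Y \<subseteq> W}"
  by (auto simp: Upper_def)

lemma Lower_inclusion_order:
  "C X \<Longrightarrow> C Y \<Longrightarrow> Lower (inclusion_order C) {X, Y} = {W. C W \<and> W \<subseteq> X \<and> W \<subseteq> Y}"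
  by (auto simp: Lower_def)

lemma least_Upper_inclusion_order:
  assumes "C X" "C Y"
  shows "least (inclusion_order C) Z (Upper (inclusion_order C) {X, Y}) \<longleftrightarrow>
     C Z \<and> X \<subseteq> Z \<and> Y \<subseteq> Z \<and> (\<forall>W. C W \<longrightarrow> X \<subseteq> W \<longrightarrow> Y \<subseteq> W \<longrightarrow> Z \<subseteq> W)"
  unfolding Upper_inclusion_order[of C, OF assms] least_def by auto

lemma greatest_Lower_inclusion_order:
  assumes "C X" "C Y"
  shows "greatest (inclusion_order C) Z (Lower (inclusion_order C) {X, Y}) \<longleftrightarrow>
     C Z \<and> Z \<subseteq> X \<and> Z \<subseteq> Y \<and> (\<forall>W. C W \<longrightarrow> W \<subseteq> X \<longrightarrow> W \<subseteq> Y \<longrightarrow> W \<subseteq> Z)"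
  unfolding Lower_inclusion_order[of C, OF assms] greatest_def by auto

lemma lattice_inclusion_order:
  assumes "\<And>X Y. C X \<Longrightarrow> C Y \<Longrightarrow>
      \<exists>Z. C Z \<and> X \<subseteq> Z \<and> Y \<subseteq> Z \<and> (\<forall>W. C W \<longrightarrow> X \<subseteq> W \<longrightarrow> Y \<subseteq> W \<longrightarrow> Z \<subseteq> W)"
    and "\<And>X Y. C X \<Longrightarrow> C Y \<Longrightarrow>
      \<exists>Z. C Z \<and> Z \<subseteq> X \<and> Z \<subseteq> Y \<and> (\<forall>W. C W \<longrightarrow> W \<subseteq> X \<longrightarrow> W \<subseteq> Y \<longrightarrow> W \<subseteq> Z)"
  shows "Lattice.lattice (inclusion_order C)"
proof -
  interpret Order.partial_order "inclusion_order C" by (rule partial_order_inclusion_order)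
  show ?thesis
  proof unfold_locales
    fix X Y assume "X \<in> carrier (inclusion_order C)" "Y \<in> carrier (inclusion_order C)"
    then have XY: "C X" "C Y" by auto
    show "\<exists>s. least (inclusion_order C) s (Upper (inclusion_order C) {X, Y})"
      using assms(1)[OF XY] XY by (simp add: least_Upper_inclusion_order)
    show "\<exists>s. greatest (inclusion_order C) s (Lower (inclusion_order C) {X, Y})"
      using assms(2)[OF XY] XY by (simp add: greatest_Lower_inclusion_order)
  qed
qed

lemma join_inclusion_order_eq:
  assumes "Lattice.lattice (inclusion_order C)" "C X" "C Y"
    and "C Z" "X \<subseteq> Z" "Y \<subseteq> Z" "\<And>W. C W \<Longrightarrow> X \<subseteq> W \<Longrightarrow> Y \<subseteq> W \<Longrightarrow> Z \<subseteq> W"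
  shows "X \<squnion>\<^bsub>inclusion_order C\<^esub> Y = Z"
proof -
  interpret Lattice.lattice "inclusion_order C" by fact
  show ?thesis
  proof (rule joinI)
    fix l assume "least (inclusion_order C) l (Upper (inclusion_order C) {X, Y})"
    then have l: "C l" "X \<subseteq> l" "Y \<subseteq> l" "\<And>W. C W \<Longrightarrow> X \<subseteq> W \<Longrightarrow> Y \<subseteq> W \<Longrightarrow> l \<subseteq> W"
      using assms(2,3) by (simp_all add: least_Upper_inclusion_order)
    show "l = Z"
      using l(4)[OF assms(4-6)] assms(7)[OF l(1-3)] by blast
  qed (simp_all add: assms(2,3))
qed

lemma meet_inclusion_order_eq:
  assumes "Lattice.lattice (inclusion_order C)" "C X" "C Y"
    and "C Z" "Z \<subseteq> X" "Z \<subseteq> Y" "\<And>W. C W \<Longrightarrow> W \<subseteq> X \<Longrightarrow> W \<subseteq> Y \<Longrightarrow> W \<subseteq> Z"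
  shows "X \<sqinter>\<^bsub>inclusion_order C\<^esub> Y = Z"
proof -
  interpret Lattice.lattice "inclusion_order C" by fact
  show ?thesis
  proof (rule meetI)
    fix l assume "greatest (inclusion_order C) l (Lower (inclusion_order C) {X, Y})"
    then have l: "C l" "l \<subseteq> X" "l \<subseteq> Y" "\<And>W. C W \<Longrightarrow> W \<subseteq> X \<Longrightarrow> W \<subseteq> Y \<Longrightarrow> W \<subseteq> l"
      using assms(2,3) by (simp_all add: greatest_Lower_inclusion_order)
    show "l = Z"
      using l(4)[OF assms(4-6)] assms(7)[OF l(1-3)] by blast
  qed (simp_all add: assms(2,3))
qed

text \<open>An order isomorphism suffices. Intersections are meets in \<open>C'\<close>, and the
  intersection of all upper bounds, of which \<open>T\<close> is one, is a join; \<open>g\<close>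
  carries both back, so joins in \<open>C\<close> never have to be described directly.\<close>

lemma lattice_isomorphism_inclusion_order:
  assumes inter: "\<And>S. S \<noteq> {} \<Longrightarrow> (\<And>X. X \<in> S \<Longrightarrow> C' X) \<Longrightarrow> C' (\<Inter>S)"
    and top: "C' T" "\<And>X. C' X \<Longrightarrow> X \<subseteq> T"
    and f: "\<And>X. C X \<Longrightarrow> C' (f X)" and g: "\<And>Y. C' Y \<Longrightarrow> C (g Y)"
    and fg: "\<And>Y. C' Y \<Longrightarrow> f (g Y) = Y"
    and mono: "\<And>X Y. C X \<Longrightarrow> C Y \<Longrightarrow> f X \<subseteq> f Y \<longleftrightarrow> X \<subseteq> Y"
  shows "lattice_isomorphism (inclusion_order C) (inclusion_order C') f"
proof -
  define sp where "sp X Y = \<Inter>{Z. C' Z \<and> X \<subseteq> Z \<and> Y \<subseteq> Z}" for X Y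
  have C'sp: "C' (sp X Y)" if "C' X" "C' Y" for X Y
    unfolding sp_def by (rule inter) (use that top in auto)
  have spI: "X \<subseteq> sp X Y" "Y \<subseteq> sp X Y" "\<And>W. C' W \<Longrightarrow> X \<subseteq> W \<Longrightarrow> Y \<subseteq> W \<Longrightarrow> sp X Y \<subseteq> W" for X Y
    unfolding sp_def by auto
  have C'int: "C' (X \<inter> Y)" if "C' X" "C' Y" for X Y
    using inter[of "{X, Y}"] that by auto
  \<comment> \<open>Being inverse to an order embedding, \<open>g\<close> is both left and right
    adjoint to \<open>f\<close>.\<close>
  have adj1: "g Y \<subseteq> X \<longleftrightarrow> Y \<subseteq> f X" and adj2: "X \<subseteq> g Y \<longleftrightarrow> f X \<subseteq> Y" if "C X" "C' Y" for X Y
    using mono[OF g[OF that(2)] that(1)] mono[OF that(1) g[OF that(2)]] that by (auto simp: fg)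
  have C'lat: "Lattice.lattice (inclusion_order C')"
  proof (rule lattice_inclusion_order)
    fix X Y assume "C' X" "C' Y"
    then show "\<exists>Z. C' Z \<and> X \<subseteq> Z \<and> Y \<subseteq> Z \<and> (\<forall>W. C' W \<longrightarrow> X \<subseteq> W \<longrightarrow> Y \<subseteq> W \<longrightarrow> Z \<subseteq> W)"
      using C'sp spI by meson
    show "\<exists>Z. C' Z \<and> Z \<subseteq> X \<and> Z \<subseteq> Y \<and> (\<forall>W. C' W \<longrightarrow> W \<subseteq> X \<longrightarrow> W \<subseteq> Y \<longrightarrow> W \<subseteq> Z)"
      by (rule exI[of _ "X \<inter> Y"]) (use C'int \<open>C' X\<close> \<open>C' Y\<close> in auto)
  qed
  have join: "C (g (sp (f X) (f Y)))" "X \<subseteq> g (sp (f X) (f Y))" "Y \<subseteq> g (sp (f X) (f Y))"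
    "\<And>W. C W \<Longrightarrow> X \<subseteq> W \<Longrightarrow> Y \<subseteq> W \<Longrightarrow> g (sp (f X) (f Y)) \<subseteq> W" if "C X" "C Y" for X Y
    using that by (simp_all add: adj1 adj2 f g C'sp mono spI)
  have meet: "C (g (f X \<inter> f Y))" "g (f X \<inter> f Y) \<subseteq> X" "g (f X \<inter> f Y) \<subseteq> Y"
    "\<And>W. C W \<Longrightarrow> W \<subseteq> X \<Longrightarrow> W \<subseteq> Y \<Longrightarrow> W \<subseteq> g (f X \<inter> f Y)" if "C X" "C Y" for X Y
    using that by (simp_all add: adj1 adj2 f g C'int mono)
  have Clat: "Lattice.lattice (inclusion_order C)"
  proof (rule lattice_inclusion_order)
    fix X Y assume XY: "C X" "C Y"
    show "\<exists>Z. C Z \<and> X \<subseteq> Z \<and> Y \<subseteq> Z \<and> (\<forall>W. C W \<longrightarrow> X \<subseteq> W \<longrightarrow> Y \<subseteq> W \<longrightarrow> Z \<subseteq> W)"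
      using join[OF XY] by meson
    show "\<exists>Z. C Z \<and> Z \<subseteq> X \<and> Z \<subseteq> Y \<and> (\<forall>W. C W \<longrightarrow> W \<subseteq> X \<longrightarrow> W \<subseteq> Y \<longrightarrow> W \<subseteq> Z)"
      using meet[OF XY] by meson
  qed
  have "f (X \<squnion>\<^bsub>inclusion_order C\<^esub> Y) = f X \<squnion>\<^bsub>inclusion_order C'\<^esub> f Y \<and>
      f (X \<sqinter>\<^bsub>inclusion_order C\<^esub> Y) = f X \<sqinter>\<^bsub>inclusion_order C'\<^esub> f Y" if XY: "C X" "C Y" for X Y
  proof -
    have "X \<squnion>\<^bsub>inclusion_order C\<^esub> Y = g (sp (f X) (f Y))"
      using join[OF XY] by (intro join_inclusion_order_eq[OF Clat XY])
    moreover have "f X \<squnion>\<^bsub>inclusion_order C'\<^esub> f Y = sp (f X) (f Y)"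
      using XY f C'sp spI by (intro join_inclusion_order_eq[OF C'lat]) auto
    moreover have "X \<sqinter>\<^bsub>inclusion_order C\<^esub> Y = g (f X \<inter> f Y)"
      using meet[OF XY] by (intro meet_inclusion_order_eq[OF Clat XY])
    moreover have "f X \<sqinter>\<^bsub>inclusion_order C'\<^esub> f Y = f X \<inter> f Y"
      using XY f C'int by (intro meet_inclusion_order_eq[OF C'lat]) auto
    ultimately show ?thesis
      using XY by (simp add: fg f C'sp C'int)
  qed
  moreover have "bij_betw f {X. C X} {X. C' X}"
    unfolding bij_betw_def inj_on_def
  proof safe
    fix X Y assume "C X" "C Y" "f X = f Y"
    then have "X \<subseteq> Y" "Y \<subseteq> X" using mono[of X Y] mono[of Y X] by simp_all
    then show "x \<in> X \<Longrightarrow> x \<in> Y" "x \<in> Y \<Longrightarrow> x \<in> X" for x by auto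
  next
    fix Y assume "C' Y" then show "Y \<in> f ` Collect C" using fg[of Y] g[of Y] by (metis imageI mem_Collect_eq)
  qed (use f in auto)
  ultimately show ?thesis
    unfolding lattice_isomorphism_def using Clat C'lat by simp
qed


subsection \<open>Derivatives of regular languages\<close>

lemma left_derivative_append: "left_derivative (u @ v) L = left_derivative v (left_derivative u L)"
  by (auto simp: left_derivative_def)

lemma right_derivative_append: "right_derivative L (u @ v) = right_derivative (right_derivative L v) u"
  by (auto simp: right_derivative_def)

lemma left_right_derivative:
  "left_derivative u (right_derivative L v) = right_derivative (left_derivative u L) v"
  by (auto simp: left_derivative_def right_derivative_def)

lemma left_derivative_lists: "L \<subseteq> lists \<Sigma> \<Longrightarrow> left_derivative u L \<subseteq> lists \<Sigma>"
  by (auto simp: left_derivative_def)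

lemma right_derivative_lists: "L \<subseteq> lists \<Sigma> \<Longrightarrow> right_derivative L u \<subseteq> lists \<Sigma>"
  by (auto simp: right_derivative_def)

text \<open>The left derivative by a word depends only on the state which that word reaches.\<close>

lemma finite_left_derivatives:
  assumes "regular \<Sigma> L"
  shows "L \<subseteq> lists \<Sigma> \<and> finite ((\<lambda>w. left_derivative w L) ` lists \<Sigma>)"
proof -
  from assms obtain Q :: "nat set" and \<delta> q0 F where Q: "finite Q" "q0 \<in> Q" "F \<subseteq> Q"
    "\<forall>q\<in>Q. \<forall>a\<in>\<Sigma>. \<delta> q a \<in> Q" and L: "L = {w \<in> lists \<Sigma>. foldl \<delta> q0 w \<in> F}"
    unfolding regular_def by blast
  have "foldl \<delta> q w \<in> Q" if "w \<in> lists \<Sigma>" "q \<in> Q" for q w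
    using that by (induction w arbitrary: q) (use Q in auto)
  then have "(\<lambda>w. left_derivative w L) ` lists \<Sigma> \<subseteq> (\<lambda>q. {u \<in> lists \<Sigma>. foldl \<delta> q u \<in> F}) ` Q"
    using Q(2) by (fastforce simp: L left_derivative_def)
  then show "L \<subseteq> lists \<Sigma> \<and> finite ((\<lambda>w. left_derivative w L) ` lists \<Sigma>)"
    using finite_subset Q(1) L by blast
qed

text \<open>The minimal automaton: its states are the left derivatives, numbered by
  \<open>enc\<close> because states are natural numbers, and the final ones are those that contain
  the empty word.\<close>

lemma regular_if_finite_left_derivatives:
  assumes L: "L \<subseteq> lists \<Sigma>" and fin: "finite ((\<lambda>w. left_derivative w L) ` lists \<Sigma>)" (is "finite ?W")
  shows "regular \<Sigma> L"
proof -
  from finite_imp_inj_to_nat_seg[OF fin]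
  obtain enc :: "'a list set \<Rightarrow> nat" where enc: "inj_on enc ?W" by auto
  define \<delta> where "\<delta> q a = enc (left_derivative [a] (inv_into ?W enc q))" for q a
  have step: "\<delta> (enc (left_derivative w L)) a = enc (left_derivative (w @ [a]) L)" if "w \<in> lists \<Sigma>" for w a
    using that enc by (simp add: \<delta>_def left_derivative_append inv_into_f_f)
  have run: "foldl \<delta> (enc L) w = enc (left_derivative w L)" if "w \<in> lists \<Sigma>" for w
    using that
  proof (induction w rule: rev_induct)
    case Nil then show ?case by (simp add: left_derivative_def)
  next
    case (snoc a w) then show ?case using step[of w a] by simp
  qed
  show "regular \<Sigma> L"
    unfolding regular_def
  proof (rule exI[of _ "enc ` ?W"], rule exI[of _ \<delta>], rule exI[of _ "enc L"],
      rule exI[of _ "enc ` {K \<in> ?W. [] \<in> K}"], intro conjI)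
    have "left_derivative [] L \<in> ?W" by (intro imageI) simp
    then show "enc L \<in> enc ` ?W" by (simp add: left_derivative_def)
    show "\<forall>q\<in>enc ` ?W. \<forall>a\<in>\<Sigma>. \<delta> q a \<in> enc ` ?W"
    proof (intro ballI)
      fix q a assume "q \<in> enc ` ?W" and a: "a \<in> \<Sigma>"
      then obtain w where q: "q = enc (left_derivative w L)" and w: "w \<in> lists \<Sigma>" by blast
      have "left_derivative (w @ [a]) L \<in> ?W" using w a by (intro imageI) auto
      then show "\<delta> q a \<in> enc ` ?W" by (simp add: step w q)
    qed
    have "w \<in> L \<longleftrightarrow> foldl \<delta> (enc L) w \<in> enc ` {K \<in> ?W. [] \<in> K}" if w: "w \<in> lists \<Sigma>" for w
    proof -
      have "enc (left_derivative w L) \<in> enc ` {K \<in> ?W. [] \<in> K} \<longleftrightarrow> left_derivative w L \<in> {K \<in> ?W. [] \<in> K}"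
        using enc by (intro inj_on_image_mem_iff) (use w in auto)
      then show ?thesis using w by (auto simp: run left_derivative_def)
    qed
    then show "L = {w \<in> lists \<Sigma>. foldl \<delta> (enc L) w \<in> enc ` {K \<in> ?W. [] \<in> K}}"
      using L by blast
  qed (use fin in auto)
qed

lemma Myhill_Nerode:
  "regular \<Sigma> L \<longleftrightarrow> L \<subseteq> lists \<Sigma> \<and> finite ((\<lambda>w. left_derivative w L) ` lists \<Sigma>)"
  using finite_left_derivatives regular_if_finite_left_derivatives by blast

lemma regular_imp_lists: "regular \<Sigma> L \<Longrightarrow> L \<subseteq> lists \<Sigma>"
  by (simp add: Myhill_Nerode)

text \<open>Derivatives on the two sides commute and each side composes, so one derivative on each
  side already yields the least derivative-closed set containing \<open>L\<close>.\<close>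

definition derivatives :: "'a set \<Rightarrow> 'a list set \<Rightarrow> 'a list set set" where
  "derivatives \<Sigma> L = {right_derivative (left_derivative u L) v | u v. u \<in> lists \<Sigma> \<and> v \<in> lists \<Sigma>}"

lemma self_in_derivatives: "L \<in> derivatives \<Sigma> L"
proof -
  have "L = right_derivative (left_derivative [] L) []"
    by (simp add: left_derivative_def right_derivative_def)
  then show ?thesis unfolding derivatives_def by blast
qed

lemma derivative_closed_derivatives: "derivative_closed \<Sigma> (derivatives \<Sigma> L)"
  unfolding derivative_closed_def
proof (intro ballI)
  fix K w assume "K \<in> derivatives \<Sigma> L" and w: "w \<in> lists \<Sigma>"
  then obtain u v where K: "u \<in> lists \<Sigma>" "v \<in> lists \<Sigma>"
    "K = right_derivative (left_derivative u L) v"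
    unfolding derivatives_def by blast
  have "left_derivative w K = right_derivative (left_derivative (u @ w) L) v"
    by (simp add: K left_right_derivative left_derivative_append)
  moreover have "right_derivative K w = right_derivative (left_derivative u L) (w @ v)"
    by (simp add: K right_derivative_append)
  moreover have "u @ w \<in> lists \<Sigma>" "w @ v \<in> lists \<Sigma>" using K w by auto
  ultimately show "left_derivative w K \<in> derivatives \<Sigma> L \<and> right_derivative K w \<in> derivatives \<Sigma> L"
    unfolding derivatives_def using K by blast
qed

lemma derivatives_subset: "derivative_closed \<Sigma> V \<Longrightarrow> L \<in> V \<Longrightarrow> derivatives \<Sigma> L \<subseteq> V"
  unfolding derivative_closed_def derivatives_def by blast

text \<open>The right derivative \<open>K v\<^sup>-\<^sup>1\<close> is determined by the set of those left derivatives of \<open>K\<close> that contain \<open>v\<close>.\<close>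

lemma finite_derivatives:
  assumes "regular \<Sigma> L"
  shows "finite (derivatives \<Sigma> L)"
proof -
  let ?W = "\<lambda>K. (\<lambda>w. left_derivative w K) ` lists \<Sigma>"
  have L: "L \<subseteq> lists \<Sigma>" "finite (?W L)" using assms by (auto simp: Myhill_Nerode)
  have fin: "finite (right_derivative K ` lists \<Sigma>)" if K: "K \<in> ?W L" for K
  proof -
    have KL: "K \<subseteq> lists \<Sigma>" using K L left_derivative_lists by blast
    obtain x where "x \<in> lists \<Sigma>" "K = left_derivative x L" using K by blast
    \<comment> \<open>A left derivative of a left derivative of \<open>L\<close> is again one of
      \<open>L\<close>, so \<open>K\<close> has only finitely many.\<close>
    then have "?W K \<subseteq> ?W L" by (auto simp flip: left_derivative_append intro!: imageI)
    then have "finite (?W K)" using L(2) finite_subset by blast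
    have eq: "right_derivative K v = {u \<in> lists \<Sigma>. left_derivative u K \<in> {M \<in> ?W K. v \<in> M}}"
      if "v \<in> lists \<Sigma>" for v
    proof -
      have "left_derivative u K \<in> ?W K" if "u \<in> lists \<Sigma>" for u using that by blast
      moreover have "v \<in> left_derivative u K \<longleftrightarrow> u \<in> right_derivative K v" for u
        by (simp add: left_derivative_def right_derivative_def)
      ultimately show ?thesis using right_derivative_lists[OF KL] by blast
    qed
    have "right_derivative K ` lists \<Sigma> \<subseteq> (\<lambda>X. {u \<in> lists \<Sigma>. left_derivative u K \<in> X}) ` Pow (?W K)"
    proof
      fix M assume "M \<in> right_derivative K ` lists \<Sigma>"
      then obtain v where "v \<in> lists \<Sigma>" "M = right_derivative K v" by blast
      then show "M \<in> (\<lambda>X. {u \<in> lists \<Sigma>. left_derivative u K \<in> X}) ` Pow (?W K)"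
        using eq by (intro image_eqI[of _ _ "{M \<in> ?W K. v \<in> M}"]) auto
    qed
    then show ?thesis using \<open>finite (?W K)\<close> by (meson finite_Pow_iff finite_imageI finite_subset)
  qed
  have "derivatives \<Sigma> L = (\<Union>K\<in>?W L. right_derivative K ` lists \<Sigma>)"
    unfolding derivatives_def by auto
  then show ?thesis by (simp only: finite_UN_I[OF L(2) fin])
qed


subsection \<open>Congruences and quotients\<close>

text \<open>For posets this is the pullback of the order, a preorder; by antisymmetry it also
  decides equality of values.\<close>

definition kernel_rel :: "dcat \<Rightarrow> 'f dstruct \<Rightarrow> ('f, 'b) gen \<Rightarrow> ('f \<times> 'f) set" where
  "kernel_rel D F = (\<lambda>(A, e). {(x, y). x \<in> carrier F \<and> y \<in> carrier F \<and>
     (if D = Posets then (e x, e y) \<in> order_rel A else e x = e y)})"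

text \<open>Translation by one element at a time is enough: transitivity gives compatibility in both
  arguments, commutativity the other side of addition. Scalars are 0 and 1, hence respected
  automatically.\<close>

definition dcongruence :: "dcat \<Rightarrow> 'f dstruct \<Rightarrow> ('f \<times> 'f) set \<Rightarrow> bool" where
  "dcongruence D F r \<longleftrightarrow>
     r \<subseteq> carrier F \<times> carrier F \<and> refl_on (carrier F) r \<and> trans r \<and> (D \<noteq> Posets \<longrightarrow> sym r) \<and>
     (D = Posets \<longrightarrow> order_rel F \<subseteq> r) \<and>
     (\<forall>(x, y)\<in>r. \<forall>z\<in>carrier F. (z \<otimes>\<^bsub>F\<^esub> x, z \<otimes>\<^bsub>F\<^esub> y) \<in> r \<and> (x \<otimes>\<^bsub>F\<^esub> z, y \<otimes>\<^bsub>F\<^esub> z) \<in> r) \<and>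
     (D = JoinSemilattices \<or> D = VectorSpacesZ2 \<longrightarrow>
       (\<forall>(x, y)\<in>r. \<forall>z\<in>carrier F. (x \<oplus>\<^bsub>F\<^esub> z, y \<oplus>\<^bsub>F\<^esub> z) \<in> r))"

lemma dcongruenceD:
  assumes "dcongruence D F r"
  shows "(x, y) \<in> r \<Longrightarrow> x \<in> carrier F" "(x, y) \<in> r \<Longrightarrow> y \<in> carrier F"
    "x \<in> carrier F \<Longrightarrow> (x, x) \<in> r" "(x, y) \<in> r \<Longrightarrow> (y, z) \<in> r \<Longrightarrow> (x, z) \<in> r"
    "D \<noteq> Posets \<Longrightarrow> (x, y) \<in> r \<Longrightarrow> (y, x) \<in> r"
    "D = Posets \<Longrightarrow> (x, y) \<in> order_rel F \<Longrightarrow> (x, y) \<in> r"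
    "(x, y) \<in> r \<Longrightarrow> z \<in> carrier F \<Longrightarrow> (z \<otimes>\<^bsub>F\<^esub> x, z \<otimes>\<^bsub>F\<^esub> y) \<in> r"
    "(x, y) \<in> r \<Longrightarrow> z \<in> carrier F \<Longrightarrow> (x \<otimes>\<^bsub>F\<^esub> z, y \<otimes>\<^bsub>F\<^esub> z) \<in> r"
    "D = JoinSemilattices \<or> D = VectorSpacesZ2 \<Longrightarrow> (x, y) \<in> r \<Longrightarrow> z \<in> carrier F \<Longrightarrow>
      (x \<oplus>\<^bsub>F\<^esub> z, y \<oplus>\<^bsub>F\<^esub> z) \<in> r"
  using assms unfolding dcongruence_def refl_on_def trans_def sym_def by (blast, blast, blast, blast, blast, blast, fast, fast, fast)

lemma dmonoid_closed:
  assumes "dmonoid D F" "x \<in> carrier F" "y \<in> carrier F"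
  shows "x \<otimes>\<^bsub>F\<^esub> y \<in> carrier F"
    "D = JoinSemilattices \<or> D = VectorSpacesZ2 \<Longrightarrow> x \<oplus>\<^bsub>F\<^esub> y \<in> carrier F"
proof -
  interpret Group.monoid F using assms(1) by (simp add: dmonoid_def)
  show "x \<otimes>\<^bsub>F\<^esub> y \<in> carrier F" using assms(2,3) by simp
  assume "D = JoinSemilattices \<or> D = VectorSpacesZ2"
  then have "abelian_monoid F" using assms(1) by (auto simp: dmonoid_def module_def abelian_group_def)
  then show "x \<oplus>\<^bsub>F\<^esub> y \<in> carrier F" using abelian_monoidE(1) assms(2,3) by metis
qed

lemma dmonoid_one_closed: "dmonoid D F \<Longrightarrow> \<one>\<^bsub>F\<^esub> \<in> carrier F"
  by (simp add: dmonoid_def monoid.one_closed)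

lemma dmonoid_zero_closed: "dmonoid JoinSemilattices F \<Longrightarrow> \<zero>\<^bsub>F\<^esub> \<in> carrier F"
  by (simp add: dmonoid_def abelian_monoid.zero_closed)

lemma dmonoid_partial_order: "dmonoid Posets A \<Longrightarrow> partial_order_on (carrier A) (order_rel A)"
  by (simp add: dmonoid_def)

lemma dmonoid_morphismD:
  assumes "dmonoid_morphism D A B h"
  shows "x \<in> carrier A \<Longrightarrow> h x \<in> carrier B"
    "x \<in> carrier A \<Longrightarrow> y \<in> carrier A \<Longrightarrow> h (x \<otimes>\<^bsub>A\<^esub> y) = h x \<otimes>\<^bsub>B\<^esub> h y"
    "h \<one>\<^bsub>A\<^esub> = \<one>\<^bsub>B\<^esub>"
    "D = Posets \<Longrightarrow> (x, y) \<in> order_rel A \<Longrightarrow> (h x, h y) \<in> order_rel B"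
    "D = JoinSemilattices \<Longrightarrow> h \<zero>\<^bsub>A\<^esub> = \<zero>\<^bsub>B\<^esub>"
    "D = JoinSemilattices \<or> D = VectorSpacesZ2 \<Longrightarrow> x \<in> carrier A \<Longrightarrow> y \<in> carrier A \<Longrightarrow>
      h (x \<oplus>\<^bsub>A\<^esub> y) = h x \<oplus>\<^bsub>B\<^esub> h y"
    "D = VectorSpacesZ2 \<Longrightarrow> x \<in> carrier A \<Longrightarrow> h (c \<odot>\<^bsub>A\<^esub> x) = c \<odot>\<^bsub>B\<^esub> h x"
  using assms unfolding dmonoid_morphism_def dmorphism_def hom_def by auto

lemma dmonoid_morphismI:
  assumes "\<And>x. x \<in> carrier A \<Longrightarrow> h x \<in> carrier B"
    and "\<And>x y. x \<in> carrier A \<Longrightarrow> y \<in> carrier A \<Longrightarrow> h (x \<otimes>\<^bsub>A\<^esub> y) = h x \<otimes>\<^bsub>B\<^esub> h y"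
    and "h \<one>\<^bsub>A\<^esub> = \<one>\<^bsub>B\<^esub>"
    and "\<And>x y. D = Posets \<Longrightarrow> (x, y) \<in> order_rel A \<Longrightarrow> (h x, h y) \<in> order_rel B"
    and "D = JoinSemilattices \<Longrightarrow> h \<zero>\<^bsub>A\<^esub> = \<zero>\<^bsub>B\<^esub>"
    and "\<And>x y. D = JoinSemilattices \<or> D = VectorSpacesZ2 \<Longrightarrow> x \<in> carrier A \<Longrightarrow> y \<in> carrier A \<Longrightarrow>
      h (x \<oplus>\<^bsub>A\<^esub> y) = h x \<oplus>\<^bsub>B\<^esub> h y"
    and "\<And>c x. D = VectorSpacesZ2 \<Longrightarrow> x \<in> carrier A \<Longrightarrow> h (c \<odot>\<^bsub>A\<^esub> x) = c \<odot>\<^bsub>B\<^esub> h x"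
  shows "dmonoid_morphism D A B h"
  unfolding dmonoid_morphism_def dmorphism_def hom_def using assms by (cases D) auto

section \<open>Kernels and the homomorphism theorem\<close>

lemma quotient_le_imp_kernel_rel:
  assumes "quotient_le D F (A, e) (A', e')"
  shows "kernel_rel D F (A', e') \<subseteq> kernel_rel D F (A, e)"
proof -
  obtain h where h: "dmonoid_morphism D A' A h" and eq: "\<And>x. x \<in> carrier F \<Longrightarrow> e x = h (e' x)"
    using assms by (auto simp: quotient_le_def)
  then show ?thesis using dmonoid_morphismD(4)[OF h] by (auto simp: kernel_rel_def)
qed

text \<open>The map \<open>h\<close> evaluates \<open>e\<close> at a chosen preimage; for posets,
  independence of the choice uses two inequalities and antisymmetry. Of the codomains only a partial
  order is asked for, so that a subdirect product can serve as either of them.\<close>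

lemma kernel_rel_imp_quotient_le:
  assumes F: "dmonoid D F"
    and e': "dmonoid_morphism D F A' e'" "e' ` carrier F = carrier A'"
    and e: "dmonoid_morphism D F A e"
    and po: "D = Posets \<Longrightarrow> partial_order_on (carrier A) (order_rel A)"
      "D = Posets \<Longrightarrow> partial_order_on (carrier A') (order_rel A')"
    and le: "kernel_rel D F (A', e') \<subseteq> kernel_rel D F (A, e)"
  obtains h where "dmonoid_morphism D A' A h" "\<And>x. x \<in> carrier F \<Longrightarrow> h (e' x) = e x"
proof -
  define h where "h a = e (inv_into (carrier F) e' a)" for a
  have eq: "e x = e y" if "x \<in> carrier F" "y \<in> carrier F" "e' x = e' y" for x y
  proof (cases "D = Posets")
    case True
    have "(e' x, e' y) \<in> order_rel A'" "(e' y, e' x) \<in> order_rel A'"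
      using partial_order_onD(1)[OF po(2)[OF True]] that dmonoid_morphismD(1)[OF e'(1)]
      unfolding refl_on_def by metis+
    then have "(x, y) \<in> kernel_rel D F (A', e')" "(y, x) \<in> kernel_rel D F (A', e')"
      using that True by (simp_all add: kernel_rel_def)
    then have "(e x, e y) \<in> order_rel A" "(e y, e x) \<in> order_rel A"
      using le True by (auto simp: kernel_rel_def)
    then show ?thesis using partial_order_onD(3)[OF po(1)[OF True]] by (auto simp: antisym_def)
  next
    case False
    then have "(x, y) \<in> kernel_rel D F (A', e')" using that by (simp add: kernel_rel_def)
    then show ?thesis using le False by (auto simp: kernel_rel_def)
  qed
  have h: "h (e' x) = e x" if "x \<in> carrier F" for x
    unfolding h_def using that by (intro eq) (auto intro: inv_into_into f_inv_into_f)
  have ex: "\<exists>x\<in>carrier F. a = e' x" if "a \<in> carrier A'" for a using e'(2) that by blast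
  note [simp] = dmonoid_morphismD(2,6,7)[OF e'(1), symmetric] dmonoid_closed[OF F] h
  have "dmonoid_morphism D A' A h"
  proof (rule dmonoid_morphismI)
    fix a assume "a \<in> carrier A'"
    then obtain x where x: "x \<in> carrier F" "a = e' x" using ex by blast
    then show "h a \<in> carrier A" using dmonoid_morphismD(1)[OF e] by simp
    fix c assume D: "D = VectorSpacesZ2"
    then interpret module Z2 F using F by (simp add: dmonoid_def)
    have "c \<odot>\<^bsub>F\<^esub> x \<in> carrier F" using x(1) smult_closed by (simp add: Z2_def)
    then show "h (c \<odot>\<^bsub>A'\<^esub> a) = c \<odot>\<^bsub>A\<^esub> h a" using x D dmonoid_morphismD(7)[OF e] by simp
  next
    fix a b assume "a \<in> carrier A'" "b \<in> carrier A'"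
    then obtain x y where x: "x \<in> carrier F" "a = e' x" "y \<in> carrier F" "b = e' y" using ex by meson
    then show "h (a \<otimes>\<^bsub>A'\<^esub> b) = h a \<otimes>\<^bsub>A\<^esub> h b" using dmonoid_morphismD(2)[OF e] by simp
    assume "D = JoinSemilattices \<or> D = VectorSpacesZ2"
    then show "h (a \<oplus>\<^bsub>A'\<^esub> b) = h a \<oplus>\<^bsub>A\<^esub> h b" using x dmonoid_morphismD(6)[OF e] by simp
  next
    show "h \<one>\<^bsub>A'\<^esub> = \<one>\<^bsub>A\<^esub>"
      using h[OF dmonoid_one_closed[OF F]] dmonoid_morphismD(3)[OF e] dmonoid_morphismD(3)[OF e'(1)] by simp
    show "h \<zero>\<^bsub>A'\<^esub> = \<zero>\<^bsub>A\<^esub>" if "D = JoinSemilattices"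
      using h[of "\<zero>\<^bsub>F\<^esub>"] that dmonoid_zero_closed[of F] F dmonoid_morphismD(5)[OF e] dmonoid_morphismD(5)[OF e'(1)] by simp
  next
    fix a b assume D: "D = Posets" and ab: "(a, b) \<in> order_rel A'"
    then have "a \<in> carrier A'" "b \<in> carrier A'" using partial_order_onD(4)[OF po(2)[OF D]] by auto
    then obtain x y where x: "x \<in> carrier F" "a = e' x" "y \<in> carrier F" "b = e' y" using ex by meson
    then have "(x, y) \<in> kernel_rel D F (A', e')" using ab D by (simp add: kernel_rel_def)
    then show "(h a, h b) \<in> order_rel A" using x le D by (auto simp: kernel_rel_def)
  qed
  with h show thesis using that by blast
qed

lemma kernel_rel_iff:
  "(x, y) \<in> kernel_rel D F g \<longleftrightarrow> x \<in> carrier F \<and> y \<in> carrier F \<and>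
     (if D = Posets then (snd g x, snd g y) \<in> order_rel (fst g) else snd g x = snd g y)"
  by (simp add: kernel_rel_def case_prod_beta)

lemma generatedD:
  assumes "generated D F g"
  shows "dmonoid D (fst g)" "dmonoid_morphism D F (fst g) (snd g)" "snd g ` carrier F = carrier (fst g)"
  using assms by (simp_all add: generated_def case_prod_beta)

lemma dcongruence_kernel_rel:
  assumes F: "dmonoid D F" and g: "generated D F g"
  shows "dcongruence D F (kernel_rel D F g)"
proof -
  obtain A e where ge: "g = (A, e)" by (cases g)
  then have A: "dmonoid D A" and e: "dmonoid_morphism D F A e" using g by (auto simp: generated_def)
  note e' [simp] = dmonoid_morphismD(1,2,6)[OF e] dmonoid_closed[OF F] ge
  note ab = dmonoid_closed[OF A]
  show ?thesis
  proof (cases "D = Posets")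
    case True
    have po: "partial_order_on (carrier A) (order_rel A)" using dmonoid_partial_order A True by simp
    have mono: "(c \<otimes>\<^bsub>A\<^esub> a, c \<otimes>\<^bsub>A\<^esub> b) \<in> order_rel A" "(a \<otimes>\<^bsub>A\<^esub> c, b \<otimes>\<^bsub>A\<^esub> c) \<in> order_rel A"
      if "(a, b) \<in> order_rel A" "c \<in> carrier A" for a b c
      using A that True by (auto simp: dmonoid_def dmorphism_def)
    have "order_rel F \<subseteq> kernel_rel D F g"
      using dmonoid_morphismD(4)[OF e] True partial_order_onD(4)[OF dmonoid_partial_order] F
      by (auto simp: kernel_rel_def)
    then show ?thesis
      using partial_order_onD[OF po] mono True
      by (auto simp: dcongruence_def kernel_rel_def refl_on_def trans_def)
  next
    case False
    then show ?thesis
      by (auto simp: dcongruence_def kernel_rel_def refl_on_def trans_def sym_def)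
  qed
qed

text \<open>The value of \<open>e\<close> on a class serves as its name; representatives are chosen by \<open>inv_into\<close>.\<close>

definition quotient_structure :: "'f dstruct \<Rightarrow> ('f \<times> 'f) set \<Rightarrow> ('f \<Rightarrow> 'b) \<Rightarrow> 'b dstruct" where
  "quotient_structure F r e = (let s = inv_into (carrier F) e in
     \<lparr>carrier = e ` carrier F, mult = (\<lambda>a b. e (s a \<otimes>\<^bsub>F\<^esub> s b)), one = e \<one>\<^bsub>F\<^esub>,
      zero = e \<zero>\<^bsub>F\<^esub>, add = (\<lambda>a b. e (s a \<oplus>\<^bsub>F\<^esub> s b)), smult = (\<lambda>c a. e (c \<odot>\<^bsub>F\<^esub> s a)),
      order_rel = {(e x, e y) | x y. (x, y) \<in> r}\<rparr>)"

lemma Z2_cases: "c = 0 \<or> c = (1::bit)"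
  by (cases c) auto

lemma cring_Z2: "cring Z2"
proof (rule cringI)
  show "abelian_group Z2"
    by (rule abelian_groupI) (auto simp: Z2_def add.assoc intro: exI[of _ "- _"])
  show "comm_monoid Z2"
    by unfold_locales (auto simp: Z2_def mult.assoc)
qed (auto simp: Z2_def distrib_right)

text \<open>The names of the classes are left arbitrary so that a finite quotient can later be
  placed on natural numbers. Once the operations are known to be computed by those of
  \<open>F\<close> on representatives, every law is inherited from \<open>F\<close>.\<close>

lemma generated_quotient_structure:
  assumes F: "dmonoid D F" and r: "dcongruence D F r"
    and e: "\<And>x y. x \<in> carrier F \<Longrightarrow> y \<in> carrier F \<Longrightarrow> e x = e y \<longleftrightarrow> (x, y) \<in> r \<and> (y, x) \<in> r"
  shows "generated D F (quotient_structure F r e, e)" (is ?gen)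
    and "kernel_rel D F (quotient_structure F r e, e) = r" (is ?ker)
proof -
  let ?N = "quotient_structure F r e" and ?s = "inv_into (carrier F) e"
  note r' = dcongruenceD[OF r]
  note Fc [simp] = dmonoid_closed[OF F] dmonoid_one_closed[OF F]
  \<comment> \<open>The chosen representative of a class is related to \<open>x\<close> in both
    directions, which matters when \<open>r\<close> is only a preorder.\<close>
  have s: "?s (e x) \<in> carrier F" "(?s (e x), x) \<in> r" "(x, ?s (e x)) \<in> r" if "x \<in> carrier F" for x
  proof -
    show *: "?s (e x) \<in> carrier F" using that by (intro inv_into_into imageI)
    have "e (?s (e x)) = e x" using that by (intro f_inv_into_f imageI)
    then show "(?s (e x), x) \<in> r" "(x, ?s (e x)) \<in> r" using e[OF * that] by auto
  qed
  have carrier_N [simp]: "carrier ?N = e ` carrier F" by (simp add: quotient_structure_def Let_def)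
  have one_N [simp]: "\<one>\<^bsub>?N\<^esub> = e \<one>\<^bsub>F\<^esub>" and zero_N [simp]: "\<zero>\<^bsub>?N\<^esub> = e \<zero>\<^bsub>F\<^esub>"
    by (simp_all add: quotient_structure_def Let_def)
  have order_N: "order_rel ?N = {(e x, e y) | x y. (x, y) \<in> r}"
    by (simp add: quotient_structure_def Let_def)
  have order_iff: "(e x, e y) \<in> order_rel ?N \<longleftrightarrow> (x, y) \<in> r"
    if xy: "x \<in> carrier F" "y \<in> carrier F" for x y
  proof
    assume "(e x, e y) \<in> order_rel ?N"
    then obtain x' y' where *: "e x = e x'" "e y = e y'" "(x', y') \<in> r" by (auto simp: order_N)
    then show "(x, y) \<in> r" using e xy r'(1,2,4) by meson
  qed (use order_N in blast)
  \<comment> \<open>Replace one factor at a time.\<close>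
  have mult_cong: "(x \<otimes>\<^bsub>F\<^esub> y, x' \<otimes>\<^bsub>F\<^esub> y') \<in> r" if "(x, x') \<in> r" "(y, y') \<in> r" for x y x' y'
    using r'(4)[OF r'(8)[OF that(1)] r'(7)[OF that(2)]] r'(1,2) that by blast
  have mult_N [simp]: "e x \<otimes>\<^bsub>?N\<^esub> e y = e (x \<otimes>\<^bsub>F\<^esub> y)" if "x \<in> carrier F" "y \<in> carrier F" for x y
    using s[OF that(1)] s[OF that(2)] that by (simp add: quotient_structure_def Let_def e mult_cong)
  have add_N: "e x \<oplus>\<^bsub>?N\<^esub> e y = e (x \<oplus>\<^bsub>F\<^esub> y)"
    if D: "D = JoinSemilattices \<or> D = VectorSpacesZ2" and "x \<in> carrier F" "y \<in> carrier F" for x y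
  proof -
    have "abelian_monoid F" using D F by (auto simp: dmonoid_def module_def abelian_group_def)
    then have comm: "a \<oplus>\<^bsub>F\<^esub> b = b \<oplus>\<^bsub>F\<^esub> a" if "a \<in> carrier F" "b \<in> carrier F" for a b
      using that by (simp add: abelian_monoid.a_comm)
    have "(x \<oplus>\<^bsub>F\<^esub> y, x' \<oplus>\<^bsub>F\<^esub> y') \<in> r" if xx: "(x, x') \<in> r" "(y, y') \<in> r" for x y x' y'
    proof -
      have "(x \<oplus>\<^bsub>F\<^esub> y, x' \<oplus>\<^bsub>F\<^esub> y) \<in> r" "(y \<oplus>\<^bsub>F\<^esub> x', y' \<oplus>\<^bsub>F\<^esub> x') \<in> r"
        using r'(9)[OF D xx(1) r'(1)[OF xx(2)]] r'(9)[OF D xx(2) r'(2)[OF xx(1)]] by simp_all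
      moreover have "y \<oplus>\<^bsub>F\<^esub> x' = x' \<oplus>\<^bsub>F\<^esub> y" "y' \<oplus>\<^bsub>F\<^esub> x' = x' \<oplus>\<^bsub>F\<^esub> y'"
        using comm r'(1,2) xx by blast+
      ultimately show ?thesis using r'(4) by simp
    qed
    then show ?thesis
      using s[OF that(2)] s[OF that(3)] that by (simp add: quotient_structure_def Let_def e)
  qed
  have smult_N: "c \<odot>\<^bsub>?N\<^esub> e x = e (c \<odot>\<^bsub>F\<^esub> x)" "c \<odot>\<^bsub>F\<^esub> x \<in> carrier F"
    if D: "D = VectorSpacesZ2" and x: "x \<in> carrier F" for c x
  proof -
    interpret module Z2 F using D F by (simp add: dmonoid_def)
    show "c \<odot>\<^bsub>F\<^esub> x \<in> carrier F" using x smult_closed by (simp add: Z2_def)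
    \<comment> \<open>A scalar is 0 or 1, so scaling is constantly zero or the identity and hence
      passes to classes.\<close>
    have "0 \<odot>\<^bsub>F\<^esub> y = \<zero>\<^bsub>F\<^esub>" "1 \<odot>\<^bsub>F\<^esub> y = y" if "y \<in> carrier F" for y
      using smult_l_null[OF that] smult_one[OF that] by (simp_all add: Z2_def)
    then show "c \<odot>\<^bsub>?N\<^esub> e x = e (c \<odot>\<^bsub>F\<^esub> x)"
      using Z2_cases[of c] x s[OF x] by (auto simp: quotient_structure_def Let_def e)
  qed
  interpret F: Group.monoid F using F by (simp add: dmonoid_def)
  have monoid_N: "Group.monoid ?N"
    by (rule monoidI) (auto simp: F.m_assoc)
  have abelian_monoid_N: "abelian_monoid ?N" if D: "D = JoinSemilattices \<or> D = VectorSpacesZ2"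
  proof -
    interpret F: abelian_monoid F using D F by (auto simp: dmonoid_def module_def abelian_group_def)
    show ?thesis
      by (rule abelian_monoidI) (auto simp: add_N[OF D] F.a_assoc F.a_comm F.a_lcomm)
  qed
  have dobject_N: "dobject D ?N"
  proof (cases D)
    case Posets
    have "order_rel ?N \<subseteq> carrier ?N \<times> carrier ?N" using r'(1,2) by (auto simp: order_N)
    moreover have "refl_on (carrier ?N) (order_rel ?N)"
      using r'(3) by (auto simp: refl_on_def order_N)
    moreover have "trans (order_rel ?N)"
    proof (rule transI)
      fix a b c assume "(a, b) \<in> order_rel ?N" "(b, c) \<in> order_rel ?N"
      then obtain x y y' z where *: "(x, y) \<in> r" "(y', z) \<in> r" "a = e x" "b = e y" "e y' = e y" "c = e z"
        by (auto simp: order_N)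
      then have "(x, z) \<in> r" using r' e by meson
      then show "(a, c) \<in> order_rel ?N" using * by (auto simp: order_N)
    qed
    moreover have "antisym (order_rel ?N)"
    proof (rule antisymI)
      fix a b assume ab: "(a, b) \<in> order_rel ?N" "(b, a) \<in> order_rel ?N"
      then obtain x y where x: "x \<in> carrier F" "y \<in> carrier F" "a = e x" "b = e y"
        using r'(1,2) by (auto simp: order_N)
      then show "a = b" using ab by (simp add: order_iff e)
    qed
    ultimately show ?thesis using Posets by (simp add: partial_order_on_def preorder_on_def)
  next
    case JoinSemilattices
    then have "x \<oplus>\<^bsub>F\<^esub> x = x" if "x \<in> carrier F" for x using F that by (simp add: dmonoid_def)
    then show ?thesis using JoinSemilattices abelian_monoid_N by (auto simp: add_N)
  next
    case VectorSpacesZ2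
    then interpret F: module Z2 F using F by (simp add: dmonoid_def)
    interpret N: abelian_monoid ?N using VectorSpacesZ2 abelian_monoid_N by simp
    note add_N' = add_N[OF disjI2[OF VectorSpacesZ2]] and smult_N' = smult_N[OF VectorSpacesZ2]
    have [simp]: "carrier Z2 = UNIV" by (simp add: Z2_def)
    have "module Z2 ?N"
    proof (rule moduleI[OF cring_Z2])
      have inv: "\<exists>y\<in>carrier ?N. y \<oplus>\<^bsub>?N\<^esub> a = \<zero>\<^bsub>?N\<^esub>" if a: "a \<in> carrier ?N" for a
      proof -
        obtain x where x: "x \<in> carrier F" "a = e x" using a by auto
        then have "e (\<ominus>\<^bsub>F\<^esub> x) \<oplus>\<^bsub>?N\<^esub> a = \<zero>\<^bsub>?N\<^esub>" by (simp add: add_N' F.M.l_neg)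
        then show ?thesis using x by auto
      qed
      show "abelian_group ?N"
        by (rule abelian_groupI) (simp_all only: inv N.a_closed N.zero_closed N.a_assoc N.a_comm N.a_lcomm N.l_zero N.r_zero)
    qed (auto simp: add_N' smult_N' F.smult_l_distr F.smult_r_distr F.smult_assoc1 F.smult_one)
    then show ?thesis using VectorSpacesZ2 by simp
  qed simp
  have mor: "dmonoid_morphism D F ?N e"
    by (rule dmonoid_morphismI) (use r'(6) in \<open>auto simp: add_N smult_N order_N\<close>)
  have trans_N: "preserves_structure D ?N ?N (\<lambda>x. e z \<otimes>\<^bsub>?N\<^esub> x) \<and>
      preserves_structure D ?N ?N (\<lambda>x. x \<otimes>\<^bsub>?N\<^esub> e z)" if z: "z \<in> carrier F" for z
  proof -
    have FF: "preserves_structure D F F (\<lambda>x. z \<otimes>\<^bsub>F\<^esub> x)" "preserves_structure D F F (\<lambda>x. x \<otimes>\<^bsub>F\<^esub> z)"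
      using F z by (auto simp: dmonoid_def dmorphism_def)
    show ?thesis
    proof (cases D)
      case Posets
      have "(e z \<otimes>\<^bsub>?N\<^esub> a, e z \<otimes>\<^bsub>?N\<^esub> b) \<in> order_rel ?N \<and> (a \<otimes>\<^bsub>?N\<^esub> e z, b \<otimes>\<^bsub>?N\<^esub> e z) \<in> order_rel ?N"
        if ab: "(a, b) \<in> order_rel ?N" for a b
      proof -
        obtain x y where x: "(x, y) \<in> r" "a = e x" "b = e y" using ab by (auto simp: order_N)
        then have "x \<in> carrier F" "y \<in> carrier F" using r'(1,2) by blast+
        then show ?thesis using x z r'(7,8) by (simp add: order_iff)
      qed
      then show ?thesis using Posets by auto
    next
      case JoinSemilattices
      then have "\<zero>\<^bsub>F\<^esub> \<in> carrier F" using F dmonoid_zero_closed by simp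
      then show ?thesis using FF JoinSemilattices z by (auto simp: add_N)
    next
      case VectorSpacesZ2
      then show ?thesis using FF z by (auto simp: add_N smult_N)
    qed simp
  qed
  have "dmonoid D ?N"
    unfolding dmonoid_def dmorphism_def using dobject_N monoid_N trans_N by (auto simp del: preserves_structure.simps)
  then show ?gen using mor by (simp add: generated_def)
  have "(x, y) \<in> kernel_rel D F (?N, e) \<longleftrightarrow> (x, y) \<in> r" for x y
  proof (cases "x \<in> carrier F \<and> y \<in> carrier F")
    case True
    then show ?thesis using e[of x y] order_iff[of x y] r'(5)[of x y] by (auto simp: kernel_rel_iff)
  next
    case False
    then show ?thesis using r'(1,2) by (auto simp: kernel_rel_iff)
  qed
  then show ?ker by auto
qed


subsection \<open>Subdirect products\<close>

lemma listset_iff: "xs \<in> listset As \<longleftrightarrow> length xs = length As \<and> (\<forall>i<length As. xs ! i \<in> As ! i)"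
proof (induction As arbitrary: xs)
  case (Cons A As)
  show ?case
  proof (cases xs)
    case (Cons x ys)
    have "(\<forall>i<Suc (length As). (x # ys) ! i \<in> (A # As) ! i) \<longleftrightarrow> x \<in> A \<and> (\<forall>i<length As. ys ! i \<in> As ! i)"
      by (simp add: All_less_Suc2)
    then show ?thesis using Cons.IH[of ys] Cons by (auto simp: set_Cons_def)
  qed (auto simp: set_Cons_def)
qed auto

lemma subdirect_product_simps [simp]:
  "carrier (fst (subdirect_product F gs)) = tupling gs ` carrier F"
  "snd (subdirect_product F gs) = tupling gs"
  by (simp_all add: subdirect_product_def Let_def)

lemma length_tupling [simp]: "length (tupling gs x) = length gs"
  by (simp add: tupling_def)

lemma nth_tupling [simp]: "i < length gs \<Longrightarrow> tupling gs x ! i = snd (gs ! i) x"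
  by (simp add: tupling_def case_prod_beta)

lemma tupling_eq_iff: "tupling gs x = tupling gs y \<longleftrightarrow> (\<forall>g\<in>set gs. snd g x = snd g y)"
  by (simp add: tupling_def case_prod_beta)

lemma order_rel_subdirect_product:
  assumes gs: "\<And>g. g \<in> set gs \<Longrightarrow> generated D F g" and xy: "x \<in> carrier F" "y \<in> carrier F"
  shows "(tupling gs x, tupling gs y) \<in> order_rel (fst (subdirect_product F gs)) \<longleftrightarrow>
    (\<forall>g\<in>set gs. (snd g x, snd g y) \<in> order_rel (fst g))"
proof -
  have "tupling gs z \<in> listset (map carrier (map fst gs))" if "z \<in> carrier F" for z
    using dmonoid_morphismD(1)[OF generatedD(2)[OF gs[OF nth_mem]] that]
    by (simp add: listset_iff)
  then show ?thesis
    using xy by (simp add: subdirect_product_def Let_def dproduct_def all_set_conv_all_nth)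
qed

text \<open>Tuples are compared componentwise. The factor
  \<open>carrier F \<times> carrier F\<close> matters for the empty list, whose bare intersection
  would be the universal relation on the whole type.\<close>

lemma kernel_rel_subdirect_product:
  assumes gs: "\<And>g. g \<in> set gs \<Longrightarrow> generated D F g"
  shows "kernel_rel D F (subdirect_product F gs) = (carrier F \<times> carrier F) \<inter> (\<Inter>g\<in>set gs. kernel_rel D F g)"
proof -
  have "(x, y) \<in> kernel_rel D F (subdirect_product F gs) \<longleftrightarrow>
      x \<in> carrier F \<and> y \<in> carrier F \<and> (\<forall>g\<in>set gs. (x, y) \<in> kernel_rel D F g)" for x y
    using order_rel_subdirect_product[OF gs, where x = x and y = y]
    by (cases "D = Posets") (auto simp: kernel_rel_iff tupling_eq_iff)
  then show ?thesis by auto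
qed

lemma dmonoid_morphism_subdirect_product:
  assumes gs: "\<And>g. g \<in> set gs \<Longrightarrow> generated D F g" and F: "dmonoid D F"
  shows "dmonoid_morphism D F (fst (subdirect_product F gs)) (snd (subdirect_product F gs))"
  unfolding subdirect_product_simps
proof (rule dmonoid_morphismI)
  fix x y assume D: "D = Posets" and xy: "(x, y) \<in> order_rel F"
  then have "x \<in> carrier F" "y \<in> carrier F"
    using F dmonoid_partial_order partial_order_onD(4) by blast+
  moreover have "(snd g x, snd g y) \<in> order_rel (fst g)" if "g \<in> set gs" for g
    using dmonoid_morphismD(4)[OF generatedD(2)[OF gs[OF that]] D xy] .
  ultimately show "(tupling gs x, tupling gs y) \<in> order_rel (fst (subdirect_product F gs))"
    using order_rel_subdirect_product[of gs D F, OF gs] by blast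
next
  let ?S = "fst (subdirect_product F gs)"
  have one: "\<one>\<^bsub>?S\<^esub> = map one (map fst gs)" and zero: "\<zero>\<^bsub>?S\<^esub> = map zero (map fst gs)"
    and mult: "a \<otimes>\<^bsub>?S\<^esub> b = map (\<lambda>i. a ! i \<otimes>\<^bsub>fst (gs ! i)\<^esub> b ! i) [0..<length gs]"
    and add: "a \<oplus>\<^bsub>?S\<^esub> b = map (\<lambda>i. a ! i \<oplus>\<^bsub>fst (gs ! i)\<^esub> b ! i) [0..<length gs]"
    and smult: "c \<odot>\<^bsub>?S\<^esub> a = map (\<lambda>i. c \<odot>\<^bsub>fst (gs ! i)\<^esub> a ! i) [0..<length gs]" for a b c
    by (simp_all add: subdirect_product_def Let_def dproduct_def)
  have mor: "dmonoid_morphism D F (fst (gs ! i)) (snd (gs ! i))" if "i < length gs" for i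
    using generatedD(2)[OF gs[OF nth_mem[OF that]]] .
  show "tupling gs \<one>\<^bsub>F\<^esub> = \<one>\<^bsub>?S\<^esub>"
    unfolding one by (rule nth_equalityI) (simp_all add: dmonoid_morphismD(3)[OF mor])
  show "tupling gs \<zero>\<^bsub>F\<^esub> = \<zero>\<^bsub>?S\<^esub>" if "D = JoinSemilattices"
    unfolding zero by (rule nth_equalityI) (simp_all add: dmonoid_morphismD(5)[OF mor that])
  show "tupling gs (c \<odot>\<^bsub>F\<^esub> x) = c \<odot>\<^bsub>?S\<^esub> tupling gs x" if "D = VectorSpacesZ2" "x \<in> carrier F" for c x
    unfolding smult by (rule nth_equalityI) (simp_all add: dmonoid_morphismD(7)[OF mor that])
  fix x y assume xy: "x \<in> carrier F" "y \<in> carrier F"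
  show "tupling gs (x \<otimes>\<^bsub>F\<^esub> y) = tupling gs x \<otimes>\<^bsub>?S\<^esub> tupling gs y"
    unfolding mult by (rule nth_equalityI) (simp_all add: dmonoid_morphismD(2)[OF mor xy])
  show "tupling gs (x \<oplus>\<^bsub>F\<^esub> y) = tupling gs x \<oplus>\<^bsub>?S\<^esub> tupling gs y"
    if "D = JoinSemilattices \<or> D = VectorSpacesZ2"
    unfolding add by (rule nth_equalityI) (simp_all add: dmonoid_morphismD(6)[OF mor that xy])
qed simp

lemma partial_order_on_subdirect_product:
  assumes gs: "\<And>g. g \<in> set gs \<Longrightarrow> generated Posets F g"
  shows "partial_order_on (carrier (fst (subdirect_product F gs))) (order_rel (fst (subdirect_product F gs)))"
proof -
  let ?S = "fst (subdirect_product F gs)"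
  have po: "partial_order_on (carrier (fst g)) (order_rel (fst g))" if "g \<in> set gs" for g
    using dmonoid_partial_order[OF generatedD(1)[OF gs[OF that]]] .
  note ord = order_rel_subdirect_product[OF gs]
  have sub: "order_rel ?S \<subseteq> carrier ?S \<times> carrier ?S" by (simp add: subdirect_product_def Let_def)
  have ex: "\<exists>x y. x \<in> carrier F \<and> y \<in> carrier F \<and> a = tupling gs x \<and> b = tupling gs y"
    if "(a, b) \<in> order_rel ?S" for a b
    using subsetD[OF sub that] by (simp add: image_iff) blast
  have "refl_on (carrier ?S) (order_rel ?S)"
  proof -
    have "(snd g x, snd g x) \<in> order_rel (fst g)" if "g \<in> set gs" "x \<in> carrier F" for g x
      using partial_order_onD(1)[OF po[OF that(1)]] generatedD(3)[OF gs[OF that(1)]] that(2)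
      by (auto simp: refl_on_def)
    then show ?thesis by (auto simp: refl_on_def ord)
  qed
  moreover have "trans (order_rel ?S)"
  proof (rule transI)
    fix a b c assume *: "(a, b) \<in> order_rel ?S" "(b, c) \<in> order_rel ?S"
    then obtain x y z where x: "x \<in> carrier F" "y \<in> carrier F" "z \<in> carrier F"
      "a = tupling gs x" "b = tupling gs y" "c = tupling gs z" using ex by meson
    then have "(snd g x, snd g z) \<in> order_rel (fst g)" if "g \<in> set gs" for g
      using * partial_order_onD(2)[OF po[OF that]] that by (auto simp: ord dest: transD)
    then show "(a, c) \<in> order_rel ?S" using x by (simp add: ord)
  qed
  moreover have "antisym (order_rel ?S)"
  proof (rule antisymI)
    fix a b assume *: "(a, b) \<in> order_rel ?S" "(b, a) \<in> order_rel ?S"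
    then obtain x y where x: "x \<in> carrier F" "y \<in> carrier F" "a = tupling gs x" "b = tupling gs y"
      using ex by meson
    then have "snd g x = snd g y" if "g \<in> set gs" for g
      using * partial_order_onD(3)[OF po[OF that]] that by (auto simp: ord dest: antisymD)
    then show "a = b" using x by (simp add: tupling_eq_iff)
  qed
  ultimately show ?thesis using sub by (simp add: partial_order_on_def preorder_on_def)
qed

text \<open>Equal kernels give factorizations in both directions; these are mutually inverse because
  they commute with two surjections from \<open>F\<close>.\<close>

lemma isomorphic_gen_subdirect_product:
  assumes F: "dmonoid D F" and g: "generated D F g" and gs: "\<And>g. g \<in> set gs \<Longrightarrow> generated D F g"
    and ker: "kernel_rel D F g = (carrier F \<times> carrier F) \<inter> (\<Inter>g\<in>set gs. kernel_rel D F g)"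
  shows "isomorphic_gen D F g (subdirect_product F gs)"
proof -
  obtain A e where ge: "g = (A, e)" by (cases g)
  obtain S t where St: "subdirect_product F gs = (S, t)" by (cases "subdirect_product F gs")
  have e: "dmonoid_morphism D F A e" "e ` carrier F = carrier A" and A: "dmonoid D A"
    using g by (auto simp: ge generated_def)
  have t: "dmonoid_morphism D F S t"
    using dmonoid_morphism_subdirect_product[of gs D F] gs F by (simp add: St)
  have im: "t ` carrier F = carrier S" using subdirect_product_simps[of F gs] by (simp add: St)
  have ker': "kernel_rel D F (S, t) = kernel_rel D F (A, e)"
    using kernel_rel_subdirect_product[of gs D F] gs ker by (simp add: St ge)
  have po: "D = Posets \<Longrightarrow> partial_order_on (carrier A) (order_rel A)"
      "D = Posets \<Longrightarrow> partial_order_on (carrier S) (order_rel S)"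
    using A dmonoid_partial_order[of A] partial_order_on_subdirect_product[of gs F] gs
    by (simp_all add: St del: subdirect_product_simps)
  obtain h where h: "dmonoid_morphism D S A h" "\<And>x. x \<in> carrier F \<Longrightarrow> h (t x) = e x"
    using kernel_rel_imp_quotient_le[OF F t im e(1) po] ker' by blast
  obtain k where k: "dmonoid_morphism D A S k" "\<And>x. x \<in> carrier F \<Longrightarrow> k (e x) = t x"
    using kernel_rel_imp_quotient_le[OF F e t po(2,1)] ker' by blast
  have "\<forall>x\<in>carrier A. h (k x) = x" using h k e(2) by (metis (no_types, lifting) imageE)
  moreover have "\<forall>y\<in>carrier S. k (h y) = y" using h k im by (metis (no_types, lifting) imageE)
  ultimately show ?thesis
    unfolding ge St isomorphic_gen_def prod.case by (intro exI[of _ h] exI[of _ k]) (simp add: h k)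
qed


subsection \<open>Duality between congruences and sets of languages\<close>

text \<open>The comparison of truth values that matches the kernel: the order of the two-chain for
  posets, equality in the other categories.\<close>

definition dle :: "dcat \<Rightarrow> bool \<Rightarrow> bool \<Rightarrow> bool" where
  "dle D a b \<longleftrightarrow> (if D = Posets then a \<longrightarrow> b else a = b)"

text \<open>This map and \<open>language_rel\<close> form a Galois connection between relations on
  \<open>carrier F\<close> and sets of languages over \<open>\<Sigma>\<close>.\<close>

definition invariant_languages ::
  "dcat \<Rightarrow> 'a set \<Rightarrow> ('a list set \<Rightarrow> 'f \<Rightarrow> bool) \<Rightarrow> ('f \<times> 'f) set \<Rightarrow> 'a list set set" where
  "invariant_languages D \<Sigma> ev r = {L. L \<subseteq> lists \<Sigma> \<and> (\<forall>(x, y)\<in>r. dle D (ev L x) (ev L y))}"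

definition language_rel ::
  "dcat \<Rightarrow> 'f dstruct \<Rightarrow> ('a list set \<Rightarrow> 'f \<Rightarrow> bool) \<Rightarrow> 'a list set set \<Rightarrow> ('f \<times> 'f) set" where
  "language_rel D F ev \<Delta> =
     {(x, y). x \<in> carrier F \<and> y \<in> carrier F \<and> (\<forall>L\<in>\<Delta>. dle D (ev L x) (ev L y))}"

text \<open>\<open>ev L\<close> is the extension of (the characteristic function of) \<open>L\<close> to a \<open>\<D>\<close>-morphism from the
  free \<open>\<D>\<close>-monoid to the two-element object of \<open>\<D>\<close>, \<open>\<eta>\<close> is the inclusion of words, and \<open>closed\<close>
  is closure under the operations on languages that correspond to \<open>\<D>\<close>. The assumption
  \<open>separation\<close> says that the two-element object is a cogenerator, \<open>closed_approx\<close> is the finite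
  duality.\<close>

locale language_duality =
  fixes D :: dcat and F :: "'f dstruct" and \<Sigma> :: "'a set"
    and ev :: "'a list set \<Rightarrow> 'f \<Rightarrow> bool" and \<eta> :: "'a list \<Rightarrow> 'f"
    and closed :: "'a list set set \<Rightarrow> bool"
  assumes dmonoid_F: "dmonoid D F"
    and order_F: "D = Posets \<Longrightarrow> order_rel F \<subseteq> Id_on (carrier F)"
    and unit_closed: "w \<in> lists \<Sigma> \<Longrightarrow> \<eta> w \<in> carrier F"
    and ev_unit: "w \<in> lists \<Sigma> \<Longrightarrow> ev L (\<eta> w) \<longleftrightarrow> w \<in> L"
    and ev_left: "w \<in> lists \<Sigma> \<Longrightarrow> x \<in> carrier F \<Longrightarrow> ev (left_derivative w L) x \<longleftrightarrow> ev L (\<eta> w \<otimes>\<^bsub>F\<^esub> x)"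
    and ev_right: "w \<in> lists \<Sigma> \<Longrightarrow> x \<in> carrier F \<Longrightarrow> ev (right_derivative L w) x \<longleftrightarrow> ev L (x \<otimes>\<^bsub>F\<^esub> \<eta> w)"
    and ev_mult_left: "x \<in> carrier F \<Longrightarrow> y \<in> carrier F \<Longrightarrow> z \<in> carrier F \<Longrightarrow>
      (\<And>u. u \<in> lists \<Sigma> \<Longrightarrow> dle D (ev (left_derivative u L) x) (ev (left_derivative u L) y)) \<Longrightarrow>
      dle D (ev L (z \<otimes>\<^bsub>F\<^esub> x)) (ev L (z \<otimes>\<^bsub>F\<^esub> y))"
    and ev_mult_right: "x \<in> carrier F \<Longrightarrow> y \<in> carrier F \<Longrightarrow> z \<in> carrier F \<Longrightarrow>
      (\<And>u. u \<in> lists \<Sigma> \<Longrightarrow> dle D (ev (right_derivative L u) x) (ev (right_derivative L u) y)) \<Longrightarrow>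
      dle D (ev L (x \<otimes>\<^bsub>F\<^esub> z)) (ev L (y \<otimes>\<^bsub>F\<^esub> z))"
    and ev_add: "D = JoinSemilattices \<or> D = VectorSpacesZ2 \<Longrightarrow>
      x \<in> carrier F \<Longrightarrow> y \<in> carrier F \<Longrightarrow> z \<in> carrier F \<Longrightarrow>
      ev L x = ev L y \<Longrightarrow> ev L (x \<oplus>\<^bsub>F\<^esub> z) = ev L (y \<oplus>\<^bsub>F\<^esub> z)"
    and closed_invariant: "dcongruence D F r \<Longrightarrow> closed (invariant_languages D \<Sigma> ev r)"
    and closed_directed: "S \<noteq> {} \<Longrightarrow> (\<And>U. U \<in> S \<Longrightarrow> closed U) \<Longrightarrow>
      (\<And>U U'. U \<in> S \<Longrightarrow> U' \<in> S \<Longrightarrow> \<exists>W\<in>S. U \<subseteq> W \<and> U' \<subseteq> W) \<Longrightarrow> closed (\<Union>S)"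
    and separation: "dcongruence D F r \<Longrightarrow> x \<in> carrier F \<Longrightarrow> y \<in> carrier F \<Longrightarrow> (x, y) \<notin> r \<Longrightarrow>
      \<exists>L\<in>invariant_languages D \<Sigma> ev r. \<not> dle D (ev L x) (ev L y)"
    and closed_approx: "closed V \<Longrightarrow> \<forall>L\<in>V. L \<subseteq> lists \<Sigma> \<Longrightarrow> finite \<Delta> \<Longrightarrow> \<Delta> \<subseteq> V \<Longrightarrow>
      invariant_languages D \<Sigma> ev (language_rel D F ev \<Delta>) \<subseteq> V"
begin

abbreviation "inv_lang \<equiv> invariant_languages D \<Sigma> ev"
abbreviation "lang_rel \<equiv> language_rel D F ev"
abbreviation "ker \<equiv> kernel_rel D F"

definition variety :: "'a list set set \<Rightarrow> bool" where
  "variety V \<longleftrightarrow> (\<forall>L\<in>V. regular \<Sigma> L) \<and> closed V \<and> derivative_closed \<Sigma> V"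

section \<open>The Galois connection between congruences and derivative-closed sets\<close>

lemma inv_lang_antimono: "r \<subseteq> r' \<Longrightarrow> inv_lang r' \<subseteq> inv_lang r"
  by (auto simp: invariant_languages_def)

lemma subset_inv_lang_lang_rel: "(\<And>L. L \<in> \<Delta> \<Longrightarrow> L \<subseteq> lists \<Sigma>) \<Longrightarrow> \<Delta> \<subseteq> inv_lang (lang_rel \<Delta>)"
  by (auto simp: invariant_languages_def language_rel_def)

lemma lang_rel_Union: "lang_rel (\<Union>S) = (carrier F \<times> carrier F) \<inter> (\<Inter>\<Delta>\<in>S. lang_rel \<Delta>)"
  by (auto simp: language_rel_def)

lemma dcongruence_lang_rel:
  assumes "derivative_closed \<Sigma> \<Delta>"
  shows "dcongruence D F (lang_rel \<Delta>)"
  unfolding dcongruence_def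
proof (intro conjI impI)
  show "lang_rel \<Delta> \<subseteq> carrier F \<times> carrier F" by (auto simp: language_rel_def)
  show "refl_on (carrier F) (lang_rel \<Delta>)" by (auto simp: language_rel_def refl_on_def dle_def)
  show "trans (lang_rel \<Delta>)" by (auto simp: language_rel_def trans_def dle_def split: if_splits)
  show "sym (lang_rel \<Delta>)" if "D \<noteq> Posets" using that by (auto simp: language_rel_def sym_def dle_def)
  show "order_rel F \<subseteq> lang_rel \<Delta>" if "D = Posets"
    using order_F[OF that] by (auto simp: language_rel_def dle_def)
  have der: "left_derivative u L \<in> \<Delta>" "right_derivative L u \<in> \<Delta>" if "L \<in> \<Delta>" "u \<in> lists \<Sigma>" for L u
    using assms that by (auto simp: derivative_closed_def)
  note closed = dmonoid_closed[OF dmonoid_F]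
  show "\<forall>(x, y)\<in>lang_rel \<Delta>. \<forall>z\<in>carrier F.
      (z \<otimes>\<^bsub>F\<^esub> x, z \<otimes>\<^bsub>F\<^esub> y) \<in> lang_rel \<Delta> \<and> (x \<otimes>\<^bsub>F\<^esub> z, y \<otimes>\<^bsub>F\<^esub> z) \<in> lang_rel \<Delta>"
  proof clarify
    fix x y z assume xy: "(x, y) \<in> lang_rel \<Delta>" and z: "z \<in> carrier F"
    then have x: "x \<in> carrier F" "y \<in> carrier F" and le: "\<And>L. L \<in> \<Delta> \<Longrightarrow> dle D (ev L x) (ev L y)"
      by (auto simp: language_rel_def)
    have "dle D (ev L (z \<otimes>\<^bsub>F\<^esub> x)) (ev L (z \<otimes>\<^bsub>F\<^esub> y))" "dle D (ev L (x \<otimes>\<^bsub>F\<^esub> z)) (ev L (y \<otimes>\<^bsub>F\<^esub> z))"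
      if "L \<in> \<Delta>" for L
      by (rule ev_mult_left[OF x z le[OF der(1)[OF that]]] ev_mult_right[OF x z le[OF der(2)[OF that]]]; assumption)+
    then show "(z \<otimes>\<^bsub>F\<^esub> x, z \<otimes>\<^bsub>F\<^esub> y) \<in> lang_rel \<Delta> \<and> (x \<otimes>\<^bsub>F\<^esub> z, y \<otimes>\<^bsub>F\<^esub> z) \<in> lang_rel \<Delta>"
      using x z closed(1) by (simp add: language_rel_def)
  qed
  show "\<forall>(x, y)\<in>lang_rel \<Delta>. \<forall>z\<in>carrier F. (x \<oplus>\<^bsub>F\<^esub> z, y \<oplus>\<^bsub>F\<^esub> z) \<in> lang_rel \<Delta>"
    if "D = JoinSemilattices \<or> D = VectorSpacesZ2"
    using that closed(2)[OF _ _ that] ev_add[OF that] by (auto simp: language_rel_def dle_def split: if_splits)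
qed

text \<open>One inclusion is the Galois connection; for the other, \<open>separation\<close>
  provides an invariant language that refutes any pair outside \<open>r\<close>.\<close>

lemma lang_rel_inv_lang:
  assumes "dcongruence D F r"
  shows "lang_rel (inv_lang r) = r"
proof -
  have "(x, y) \<in> lang_rel (inv_lang r) \<longleftrightarrow> (x, y) \<in> r" if "x \<in> carrier F" "y \<in> carrier F" for x y
    using separation[OF assms that] that by (auto simp: language_rel_def invariant_languages_def)
  moreover have "(x, y) \<in> lang_rel (inv_lang r) \<Longrightarrow> x \<in> carrier F \<and> y \<in> carrier F" for x y
    by (simp add: language_rel_def)
  moreover have "(x, y) \<in> r \<Longrightarrow> x \<in> carrier F \<and> y \<in> carrier F" for x y
    using dcongruenceD(1,2)[OF assms] by simp
  ultimately show ?thesis by (intro equalityI subrelI) blast+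
qed

text \<open>Deriving by \<open>w\<close> amounts to evaluating after translation by
  \<open>\<eta> w\<close>, and \<open>r\<close> is stable under translations.\<close>

lemma derivative_closed_inv_lang:
  assumes r: "dcongruence D F r"
  shows "derivative_closed \<Sigma> (inv_lang r)"
  unfolding derivative_closed_def
proof (intro ballI)
  fix L w assume L: "L \<in> inv_lang r" and w: "w \<in> lists \<Sigma>"
  have LS: "L \<subseteq> lists \<Sigma>" using L by (simp add: invariant_languages_def)
  have le: "dle D (ev L x) (ev L y)" if "(x, y) \<in> r" for x y
    using L that by (auto simp: invariant_languages_def)
  have "dle D (ev (left_derivative w L) x) (ev (left_derivative w L) y)"
    "dle D (ev (right_derivative L w) x) (ev (right_derivative L w) y)" if xy: "(x, y) \<in> r" for x y
    using ev_left[OF w] ev_right[OF w] dcongruenceD(1,2)[OF r xy]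
      le[OF dcongruenceD(7)[OF r xy unit_closed[OF w]]] le[OF dcongruenceD(8)[OF r xy unit_closed[OF w]]]
    by simp_all
  then show "left_derivative w L \<in> inv_lang r \<and> right_derivative L w \<in> inv_lang r"
    using left_derivative_lists[OF LS] right_derivative_lists[OF LS] by (auto simp: invariant_languages_def)
qed

section \<open>Languages recognized by a finite generated object\<close>

lemma dcongruence_ker: "g \<in> finite_generated D F \<Longrightarrow> dcongruence D F (ker g)"
  by (rule dcongruence_kernel_rel[OF dmonoid_F]) (simp add: finite_generated_def)

text \<open>An invariant language is recovered from the image under \<open>e\<close> of the elements
  on which it evaluates to true, and a finite carrier has finitely many subsets.\<close>

lemma finite_inv_lang_ker:
  assumes "g \<in> finite_generated D F"
  shows "finite (inv_lang (ker g))"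
proof -
  define e where "e = snd g"
  note r = dcongruence_ker[OF assms]
  have A: "finite (carrier (fst g))" and im: "e ` carrier F = carrier (fst g)"
    using assms generatedD(3)[of D F g] by (simp_all add: finite_generated_def e_def)
  have eq: "L = {w \<in> lists \<Sigma>. e (\<eta> w) \<in> e ` {x \<in> carrier F. ev L x}}" if L: "L \<in> inv_lang (ker g)" for L
  proof -
    have "w \<in> L" if w: "w \<in> lists \<Sigma>" and x: "x \<in> carrier F" "ev L x" "e (\<eta> w) = e x" for w x
    proof -
      \<comment> \<open>Reflexivity at \<open>x\<close>, rewritten along
        \<open>e (\<eta> w) = e x\<close>, relates \<open>x\<close> to \<open>\<eta> w\<close> in
        the ordered and unordered cases alike.\<close>
      have "(x, x) \<in> ker g" using dcongruenceD(3)[OF r] x by blast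
      then have "(x, \<eta> w) \<in> ker g" using x unit_closed[OF w] by (auto simp: kernel_rel_iff e_def)
      then have "dle D (ev L x) (ev L (\<eta> w))" using L by (auto simp: invariant_languages_def)
      then show ?thesis using x ev_unit[OF w] by (auto simp: dle_def split: if_splits)
    qed
    moreover have "L \<subseteq> lists \<Sigma>" using L by (simp add: invariant_languages_def)
    moreover have "e (\<eta> w) \<in> e ` {x \<in> carrier F. ev L x}" if "w \<in> L" "w \<in> lists \<Sigma>" for w
      using that unit_closed ev_unit by auto
    ultimately show ?thesis by blast
  qed
  have "inv_lang (ker g) \<subseteq> (\<lambda>X. {w \<in> lists \<Sigma>. e (\<eta> w) \<in> X}) ` Pow (carrier (fst g))"
  proof
    fix L assume "L \<in> inv_lang (ker g)"
    from eq[OF this] show "L \<in> (\<lambda>X. {w \<in> lists \<Sigma>. e (\<eta> w) \<in> X}) ` Pow (carrier (fst g))"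
      using im by (intro image_eqI[of _ _ "e ` {x \<in> carrier F. ev L x}"]) auto
  qed
  then show ?thesis using A by (meson finite_Pow_iff finite_imageI finite_subset)
qed

text \<open>Regularity comes for free: all left derivatives stay inside a finite set, so the
  Myhill-Nerode criterion applies.\<close>

lemma variety_inv_lang_ker:
  assumes "g \<in> finite_generated D F"
  shows "variety (inv_lang (ker g))"
proof -
  note r = dcongruence_ker[OF assms]
  note der = derivative_closed_inv_lang[OF r]
  have "regular \<Sigma> L" if L: "L \<in> inv_lang (ker g)" for L
  proof -
    have "(\<lambda>w. left_derivative w L) ` lists \<Sigma> \<subseteq> inv_lang (ker g)"
      using der L by (auto simp: derivative_closed_def)
    then have "finite ((\<lambda>w. left_derivative w L) ` lists \<Sigma>)"
      using finite_inv_lang_ker[OF assms] finite_subset by blast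
    then show ?thesis using L by (simp add: Myhill_Nerode invariant_languages_def)
  qed
  then show ?thesis using der closed_invariant[OF r] by (simp add: variety_def)
qed

text \<open>An element is named by a number encoding the set of languages in \<open>\<Delta>\<close>
  that hold at it. Equal names mean being related in both directions, also when the relation is a
  mere preorder.\<close>

lemma ex_finite_generated:
  assumes fin: "finite \<Delta>" and der: "derivative_closed \<Sigma> \<Delta>"
  obtains g where "g \<in> finite_generated D F" "ker g = lang_rel \<Delta>"
proof -
  have "finite (Pow \<Delta>)" using fin by simp
  from finite_imp_inj_to_nat_seg[OF this] obtain enc :: "'a list set set \<Rightarrow> nat" where enc: "inj_on enc (Pow \<Delta>)"
    by auto
  define e where "e x = enc {L \<in> \<Delta>. ev L x}" for x
  have "e x = e y \<longleftrightarrow> {L \<in> \<Delta>. ev L x} = {L \<in> \<Delta>. ev L y}" for x y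
    unfolding e_def by (rule inj_on_eq_iff[OF enc]) auto
  then have "e x = e y \<longleftrightarrow> (x, y) \<in> lang_rel \<Delta> \<and> (y, x) \<in> lang_rel \<Delta>"
    if "x \<in> carrier F" "y \<in> carrier F" for x y
    using that by (auto simp: language_rel_def dle_def)
  note N = generated_quotient_structure[OF dmonoid_F dcongruence_lang_rel[OF der] this]
  have "e ` carrier F \<subseteq> enc ` Pow \<Delta>" by (auto simp: e_def)
  then have "finite (e ` carrier F)" using fin by (meson finite_Pow_iff finite_imageI finite_subset)
  then have "(quotient_structure F (lang_rel \<Delta>) e, e) \<in> finite_generated D F"
    using N(1) by (simp add: finite_generated_def quotient_structure_def Let_def)
  with N(2) show thesis using that by blast
qed

section \<open>The mutually inverse maps between varieties and pseudovarieties\<close>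

definition pseudovariety_of :: "'a list set set \<Rightarrow> ('f, nat) gen set" where
  "pseudovariety_of V = {g \<in> finite_generated D F. inv_lang (ker g) \<subseteq> V}"

definition variety_of :: "('f, nat) gen set \<Rightarrow> 'a list set set" where
  "variety_of P = (\<Union>g\<in>P. inv_lang (ker g))"

lemma varietyD:
  assumes "variety V"
  shows "closed V" "derivative_closed \<Sigma> V" "L \<in> V \<Longrightarrow> regular \<Sigma> L" "\<forall>L\<in>V. L \<subseteq> lists \<Sigma>"
  using assms regular_imp_lists by (auto simp: variety_def)

text \<open>The union of the recognized sets need not be closed under the operations on languages,
  but it is finite and derivative-closed, which is all that \<open>closed_approx\<close> and
  \<open>ex_finite_generated\<close> ask of \<open>\<Delta>\<close>.\<close>

lemma ker_subdirect_product:
  assumes gs: "set gs \<subseteq> finite_generated D F"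
  defines "\<Delta> \<equiv> \<Union>g\<in>set gs. inv_lang (ker g)"
  shows "ker (subdirect_product F gs) = lang_rel \<Delta>" "finite \<Delta>" "derivative_closed \<Sigma> \<Delta>"
proof -
  have gen: "generated D F g" if "g \<in> set gs" for g using gs that by (auto simp: finite_generated_def)
  have eq: "lang_rel (inv_lang (ker g)) = ker g" if "g \<in> set gs" for g
    using lang_rel_inv_lang dcongruence_ker gs that by blast
  have "lang_rel \<Delta> = (carrier F \<times> carrier F) \<inter> (\<Inter>g\<in>set gs. ker g)"
    unfolding \<Delta>_def lang_rel_Union using eq by auto
  then show "ker (subdirect_product F gs) = lang_rel \<Delta>"
    using kernel_rel_subdirect_product[of gs D F, OF gen] by simp
  show "finite \<Delta>" unfolding \<Delta>_def using finite_inv_lang_ker gs by blast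
  have "derivative_closed \<Sigma> (inv_lang (ker g))" if "g \<in> set gs" for g
    using derivative_closed_inv_lang dcongruence_ker gs that by blast
  then show "derivative_closed \<Sigma> \<Delta>" unfolding \<Delta>_def derivative_closed_def by blast
qed

text \<open>A quotient has a larger kernel and recognizes fewer languages. What a subdirect product
  recognizes is generated by what its factors recognize, by \<open>closed_approx\<close>, and so
  stays in \<open>V\<close>.\<close>

lemma local_pseudovariety_pseudovariety_of:
  assumes V: "variety V"
  shows "local_pseudovariety D F (pseudovariety_of V)"
  unfolding local_pseudovariety_def
proof (intro conjI ballI impI)
  show "pseudovariety_of V \<subseteq> finite_generated D F" by (auto simp: pseudovariety_of_def)
next
  fix g g' assume *: "g \<in> pseudovariety_of V" "g' \<in> finite_generated D F" "quotient_le D F g' g"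
  then have "ker g \<subseteq> ker g'" using quotient_le_imp_kernel_rel by (metis prod.collapse)
  then show "g' \<in> pseudovariety_of V"
    using * inv_lang_antimono unfolding pseudovariety_of_def by blast
next
  fix gs g assume gs: "gs \<in> lists (pseudovariety_of V)" and g: "g \<in> finite_generated D F"
    and iso: "isomorphic_gen D F g (subdirect_product F gs)"
  have "quotient_le D F g (subdirect_product F gs)"
    using iso unfolding isomorphic_gen_def quotient_le_def by (auto split: prod.splits)
  then have le: "ker (subdirect_product F gs) \<subseteq> ker g"
    using quotient_le_imp_kernel_rel by (metis prod.collapse)
  have fg: "set gs \<subseteq> finite_generated D F" using gs by (auto simp: pseudovariety_of_def)
  have "(\<Union>g\<in>set gs. inv_lang (ker g)) \<subseteq> V" using gs by (auto simp: pseudovariety_of_def)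
  from closed_approx[OF varietyD(1)[OF V] varietyD(4)[OF V] ker_subdirect_product(2)[OF fg] this]
  have "inv_lang (ker (subdirect_product F gs)) \<subseteq> V" by (simp add: ker_subdirect_product(1)[OF fg])
  then show "g \<in> pseudovariety_of V" using inv_lang_antimono[OF le] g by (auto simp: pseudovariety_of_def)
qed

text \<open>Upper bounds of finite families inside \<open>P\<close>. The member \<open>g\<close> is
  built from the common kernel, and only then seen to be isomorphic to the subdirect product. The
  empty list shows that \<open>P\<close> is inhabited.\<close>

lemma subdirect_product_mem:
  assumes P: "local_pseudovariety D F P" and gs: "set gs \<subseteq> P"
  obtains g where "g \<in> P" "\<And>g'. g' \<in> set gs \<Longrightarrow> inv_lang (ker g') \<subseteq> inv_lang (ker g)"
proof -
  have fg: "set gs \<subseteq> finite_generated D F" using P gs by (auto simp: local_pseudovariety_def)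
  then have gen: "generated D F g" if "g \<in> set gs" for g using that by (auto simp: finite_generated_def)
  note sub = ker_subdirect_product[OF fg]
  obtain g where g: "g \<in> finite_generated D F" "ker g = lang_rel (\<Union>g\<in>set gs. inv_lang (ker g))"
    using ex_finite_generated[OF sub(2,3)] .
  have keq: "ker g = (carrier F \<times> carrier F) \<inter> (\<Inter>g\<in>set gs. ker g)"
    using kernel_rel_subdirect_product[of gs D F, OF gen] sub(1) g(2) by simp
  have "generated D F g" using g by (simp add: finite_generated_def)
  then have "isomorphic_gen D F g (subdirect_product F gs)"
    using isomorphic_gen_subdirect_product[OF dmonoid_F _ gen keq] by blast
  moreover have "gs \<in> lists P" using gs by auto
  ultimately have "g \<in> P" using P g(1) by (auto simp: local_pseudovariety_def)
  moreover have "inv_lang (ker g') \<subseteq> inv_lang (ker g)" if "g' \<in> set gs" for g'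
    using keq that by (intro inv_lang_antimono) auto
  ultimately show thesis using that by blast
qed

text \<open>Subdirect products make the family of recognized sets directed, so closure under the
  finitary operations passes to its union.\<close>

lemma variety_variety_of:
  assumes P: "local_pseudovariety D F P"
  shows "variety (variety_of P)"
proof -
  have "P \<subseteq> finite_generated D F" using P by (simp add: local_pseudovariety_def)
  then have var: "variety (inv_lang (ker g))" if "g \<in> P" for g using that variety_inv_lang_ker by blast
  obtain g0 where "g0 \<in> P" using subdirect_product_mem[OF P, of "[]"] by (metis empty_set empty_subsetI)
  have "closed (\<Union>((\<lambda>g. inv_lang (ker g)) ` P))"
  proof (rule closed_directed)
    fix U U' assume "U \<in> (\<lambda>g. inv_lang (ker g)) ` P" "U' \<in> (\<lambda>g. inv_lang (ker g)) ` P"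
    then obtain g g' where g: "g \<in> P" "U = inv_lang (ker g)" "g' \<in> P" "U' = inv_lang (ker g')" by blast
    obtain h where "h \<in> P" "\<And>g''. g'' \<in> set [g, g'] \<Longrightarrow> inv_lang (ker g'') \<subseteq> inv_lang (ker h)"
      using subdirect_product_mem[OF P, of "[g, g']"] g by (metis empty_set empty_subsetI insert_subset list.simps(15))
    then show "\<exists>W\<in>(\<lambda>g. inv_lang (ker g)) ` P. U \<subseteq> W \<and> U' \<subseteq> W" unfolding g by (intro bexI[of _ "inv_lang (ker h)"]) simp_all
  qed (use \<open>g0 \<in> P\<close> var varietyD(1) in auto)
  moreover have "derivative_closed \<Sigma> (variety_of P)"
    using varietyD(2)[OF var] unfolding variety_of_def derivative_closed_def by blast
  ultimately show ?thesis
    using varietyD(3)[OF var] unfolding variety_def variety_of_def by auto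
qed

text \<open>The nontrivial inclusion is a compactness argument: \<open>g\<close> recognizes finitely
  many languages, so finitely many members of \<open>P\<close> account for them, and a single upper
  bound \<open>h\<close> in \<open>P\<close> recognizes them all. Recovering kernels from languages
  then exhibits \<open>g\<close> as a quotient of \<open>h\<close>.\<close>

lemma pseudovariety_of_variety_of:
  assumes P: "local_pseudovariety D F P"
  shows "pseudovariety_of (variety_of P) = P"
proof
  have PF: "P \<subseteq> finite_generated D F" using P by (simp add: local_pseudovariety_def)
  then show "P \<subseteq> pseudovariety_of (variety_of P)" by (auto simp: pseudovariety_of_def variety_of_def)
  show "pseudovariety_of (variety_of P) \<subseteq> P"
  proof
    fix g assume "g \<in> pseudovariety_of (variety_of P)"
    then have g: "g \<in> finite_generated D F" and le: "inv_lang (ker g) \<subseteq> (\<Union>g\<in>P. inv_lang (ker g))"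
      by (simp_all add: pseudovariety_of_def variety_of_def)
    from finite_subset_Union[OF finite_inv_lang_ker[OF g] le]
    obtain \<F> where \<F>: "finite \<F>" "\<F> \<subseteq> (\<lambda>g. inv_lang (ker g)) ` P" "inv_lang (ker g) \<subseteq> \<Union>\<F>"
      by auto
    then obtain G where G: "finite G" "G \<subseteq> P" "\<F> = (\<lambda>g. inv_lang (ker g)) ` G"
      by (meson finite_subset_image)
    obtain gs where gs: "set gs = G" using finite_list[OF G(1)] by blast
    obtain h where h: "h \<in> P" "\<And>g'. g' \<in> set gs \<Longrightarrow> inv_lang (ker g') \<subseteq> inv_lang (ker h)"
      using subdirect_product_mem[OF P, of gs] G gs by metis
    have "inv_lang (ker g) \<subseteq> inv_lang (ker h)" using h(2) \<F>(3) G(3) gs by blast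
    then have "lang_rel (inv_lang (ker h)) \<subseteq> lang_rel (inv_lang (ker g))"
      by (auto simp: language_rel_def)
    then have le: "ker h \<subseteq> ker g"
      using lang_rel_inv_lang dcongruence_ker g h(1) PF by (metis subsetD)
    have "generated D F g" "generated D F h" using g h(1) PF by (auto simp: finite_generated_def)
    note gen = generatedD[OF this(1)] generatedD[OF this(2)]
    obtain k where "dmonoid_morphism D (fst h) (fst g) k" "\<And>x. x \<in> carrier F \<Longrightarrow> k (snd h x) = snd g x"
    proof (rule kernel_rel_imp_quotient_le[OF dmonoid_F gen(5,6,2)])
      show "kernel_rel D F (fst h, snd h) \<subseteq> kernel_rel D F (fst g, snd g)" using le by simp
    qed (use gen(1,4) dmonoid_partial_order in auto)
    then have "quotient_le D F g h" by (auto simp: quotient_le_def case_prod_beta)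
    then show "g \<in> P" using P g h(1) by (auto simp: local_pseudovariety_def)
  qed
qed

text \<open>To reflect inclusion, a language of \<open>X\<close> must be recognized by some member
  of \<open>pseudovariety_of X\<close>; the quotient induced by its finitely many two-sided
  derivatives is one.\<close>

lemma pseudovariety_of_subset_iff:
  assumes X: "variety X" and Y: "variety Y"
  shows "pseudovariety_of X \<subseteq> pseudovariety_of Y \<longleftrightarrow> X \<subseteq> Y"
proof
  assume le: "pseudovariety_of X \<subseteq> pseudovariety_of Y"
  show "X \<subseteq> Y"
  proof
    fix L assume L: "L \<in> X"
    let ?\<Delta> = "derivatives \<Sigma> L"
    have sub: "?\<Delta> \<subseteq> X" by (rule derivatives_subset[OF varietyD(2)[OF X] L])
    have fin: "finite ?\<Delta>" by (rule finite_derivatives[OF varietyD(3)[OF X L]])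
    obtain g where g: "g \<in> finite_generated D F" "ker g = lang_rel ?\<Delta>"
      using ex_finite_generated[OF fin derivative_closed_derivatives] .
    have "inv_lang (ker g) \<subseteq> X"
      using closed_approx[OF varietyD(1)[OF X] varietyD(4)[OF X] fin sub] g(2) by simp
    then have "inv_lang (ker g) \<subseteq> Y" using le g(1) by (auto simp: pseudovariety_of_def)
    moreover have "?\<Delta> \<subseteq> inv_lang (ker g)"
      unfolding g(2) using sub varietyD(4)[OF X] by (intro subset_inv_lang_lang_rel) blast
    ultimately show "L \<in> Y" using self_in_derivatives by blast
  qed
qed (auto simp: pseudovariety_of_def)

text \<open>Nonempty intersections and a greatest element are immediate for pseudovarieties, which
  is why they take the role of the target.\<close>

lemma lattice_isomorphism_pseudovariety_of:
  "lattice_isomorphism (inclusion_order variety) (inclusion_order (local_pseudovariety D F)) pseudovariety_of"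
proof (rule lattice_isomorphism_inclusion_order[where g = variety_of and T = "finite_generated D F"])
  fix S :: "('f, nat) gen set set"
  assume S: "S \<noteq> {}" "\<And>P. P \<in> S \<Longrightarrow> local_pseudovariety D F P"
  have mem: "gs \<in> lists P" if "gs \<in> lists (\<Inter>S)" "P \<in> S" for gs P
    using that by auto
  show "local_pseudovariety D F (\<Inter>S)"
    unfolding local_pseudovariety_def
  proof (intro conjI ballI impI)
    show "\<Inter>S \<subseteq> finite_generated D F" using S unfolding local_pseudovariety_def by blast
    show "g' \<in> \<Inter>S" if "g \<in> \<Inter>S" "g' \<in> finite_generated D F" "quotient_le D F g' g" for g g'
      using S(2) that unfolding local_pseudovariety_def by blast
    show "g \<in> \<Inter>S" if "gs \<in> lists (\<Inter>S)" "g \<in> finite_generated D F"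
      "isomorphic_gen D F g (subdirect_product F gs)" for g gs
      using S(2) that mem unfolding local_pseudovariety_def by blast
  qed
next
  show "local_pseudovariety D F (finite_generated D F)" by (auto simp: local_pseudovariety_def)
next
  fix P assume "local_pseudovariety D F P"
  then show "P \<subseteq> finite_generated D F" by (simp add: local_pseudovariety_def)
qed (simp_all add: local_pseudovariety_pseudovariety_of variety_variety_of pseudovariety_of_variety_of
    pseudovariety_of_subset_iff)

lemma ex_lattice_isomorphism:
  assumes "\<And>V. C V \<longleftrightarrow> (\<forall>L\<in>V. regular \<Sigma> L) \<and> closed V \<and> derivative_closed \<Sigma> V"
  shows "\<exists>f. lattice_isomorphism (inclusion_order C) (inclusion_order (local_pseudovariety D F)) f"
proof -
  have "C = variety" using assms by (simp add: variety_def fun_eq_iff)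
  then show ?thesis using lattice_isomorphism_pseudovariety_of by blast
qed

end


subsection \<open>Monoids and ordered monoids\<close>

lemma Union_mem_if_finite:
  assumes "finite U" "U \<subseteq> V" "{} \<in> V" "\<And>K L. K \<in> V \<Longrightarrow> L \<in> V \<Longrightarrow> K \<union> L \<in> V"
  shows "\<Union>U \<in> V"
  using assms(1,2) by (induction U) (auto intro: assms(3,4))

text \<open>An up-set of the preorder induced by \<open>\<Delta>\<close> is the union of the
  principal up-sets of its elements. These are intersections of members of \<open>\<Delta>\<close>,
  so only finitely many are distinct.\<close>

lemma mem_lattice_if_upward_closed:
  assumes V: "{} \<in> V" "lists \<Sigma> \<in> V" "\<And>K L. K \<in> V \<Longrightarrow> L \<in> V \<Longrightarrow> K \<union> L \<in> V"
      "\<And>K L. K \<in> V \<Longrightarrow> L \<in> V \<Longrightarrow> K \<inter> L \<in> V"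
    and \<Delta>: "finite \<Delta>" "\<Delta> \<subseteq> V" and L: "L \<subseteq> lists \<Sigma>"
    and up: "\<And>x y. x \<in> L \<Longrightarrow> y \<in> lists \<Sigma> \<Longrightarrow> \<forall>K\<in>\<Delta>. x \<in> K \<longrightarrow> y \<in> K \<Longrightarrow> y \<in> L"
  shows "L \<in> V"
proof -
  have Inter: "lists \<Sigma> \<inter> \<Inter>U \<in> V" if "finite U" "U \<subseteq> V" for U
    using that
  proof (induction U)
    case (insert K U)
    then have "K \<inter> (lists \<Sigma> \<inter> \<Inter>U) \<in> V" using V(4) by simp
    then show ?case by (simp add: Int_ac)
  qed (use V in simp)
  \<comment> \<open>The principal up-set of \<open>x\<close>; intersecting with
    \<open>lists \<Sigma>\<close> covers the case that no member of \<open>\<Delta>\<close> contains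
    \<open>x\<close>.\<close>
  define A where "A x = lists \<Sigma> \<inter> \<Inter>{K \<in> \<Delta>. x \<in> K}" for x
  have "A ` L \<subseteq> (\<lambda>U. lists \<Sigma> \<inter> \<Inter>U) ` Pow \<Delta>" by (auto simp: A_def)
  then have fin: "finite (A ` L)" using \<Delta>(1) by (meson finite_Pow_iff finite_imageI finite_subset)
  have "A x \<in> V" for x unfolding A_def using \<Delta> by (intro Inter) auto
  then have "\<Union>(A ` L) \<in> V" using fin V(1,3) by (intro Union_mem_if_finite) auto
  moreover have "\<Union>(A ` L) = L"
  proof
    show "\<Union>(A ` L) \<subseteq> L"
    proof
      fix y assume "y \<in> \<Union>(A ` L)"
      then obtain x where x: "x \<in> L" "y \<in> A x" by blast
      then show "y \<in> L" by (intro up[of x y]) (auto simp: A_def)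
    qed
    show "L \<subseteq> \<Union>(A ` L)" using L by (auto simp: A_def)
  qed
  ultimately show ?thesis by simp
qed

section \<open>The free monoid and its two dualities\<close>

lemma free_monoid_simps [simp]:
  "carrier (free_monoid \<Sigma>) = lists \<Sigma>" "x \<otimes>\<^bsub>free_monoid \<Sigma>\<^esub> y = x @ y" "\<one>\<^bsub>free_monoid \<Sigma>\<^esub> = []"
  "order_rel (free_monoid \<Sigma>) = Id_on (lists \<Sigma>)"
  by (simp_all add: free_monoid_def)

lemma dmonoid_free_monoid:
  assumes "D = Sets \<or> D = Posets"
  shows "dmonoid D (free_monoid \<Sigma>)"
proof -
  have "Group.monoid (free_monoid \<Sigma>)" by (rule monoidI) auto
  moreover have "partial_order_on (lists \<Sigma>) (Id_on (lists \<Sigma>))"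
    by (auto simp: partial_order_on_def preorder_on_def refl_on_def trans_def antisym_def)
  ultimately show ?thesis using assms by (auto simp: dmonoid_def dmorphism_def)
qed

text \<open>The principal up-set of \<open>x\<close>, which is its class when \<open>r\<close> is
  symmetric, serves as separating language: it contains \<open>x\<close> and omits every
  \<open>y\<close> to which \<open>x\<close> is not related.\<close>

lemma mem_dcongruence_class:
  assumes "dcongruence D (free_monoid \<Sigma>) r"
  shows "r `` {x} \<in> invariant_languages D \<Sigma> (\<lambda>L w. w \<in> L) r"
proof -
  note r = dcongruenceD[OF assms(1)]
  have "r `` {x} \<subseteq> lists \<Sigma>" using r(2) by (auto simp del: in_lists_conv_set)
  moreover have "dle D (y \<in> r `` {x}) (z \<in> r `` {x})" if yz: "(y, z) \<in> r" for y z
  proof (cases "D = Posets")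
    case True
    then show ?thesis using r(4)[OF _ yz, of x] by (simp add: dle_def)
  next
    case False
    then show ?thesis using r(4)[OF _ yz, of x] r(4)[OF _ r(5)[OF False yz], of x] by (auto simp: dle_def)
  qed
  ultimately show ?thesis by (auto simp: invariant_languages_def)
qed

abbreviation "closed_boolean \<Sigma> V \<equiv> {} \<in> V \<and> (\<forall>K\<in>V. \<forall>L\<in>V. K \<union> L \<in> V) \<and> (\<forall>K\<in>V. \<forall>L\<in>V. K \<inter> L \<in> V) \<and>
  (\<forall>L\<in>V. lists \<Sigma> - L \<in> V)"

abbreviation "closed_lattice \<Sigma> V \<equiv> {} \<in> V \<and> lists \<Sigma> \<in> V \<and>
  (\<forall>K\<in>V. \<forall>L\<in>V. K \<union> L \<in> V) \<and> (\<forall>K\<in>V. \<forall>L\<in>V. K \<inter> L \<in> V)"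

lemma language_duality_Sets:
  "language_duality Sets (free_monoid \<Sigma>) \<Sigma> (\<lambda>L w. w \<in> L) (\<lambda>w. w) (closed_boolean \<Sigma>)"
proof unfold_locales
  let ?F = "free_monoid \<Sigma>" and ?ev = "\<lambda>L w. w \<in> L"
  show "dmonoid Sets ?F" by (simp add: dmonoid_free_monoid)
  show "closed_boolean \<Sigma> (invariant_languages Sets \<Sigma> ?ev r)" if r: "dcongruence Sets ?F r" for r
    using dcongruenceD(1,2)[OF r] unfolding invariant_languages_def dle_def
    by (auto simp del: in_lists_conv_set del: in_listsI)
  show "\<exists>L\<in>invariant_languages Sets \<Sigma> ?ev r. \<not> dle Sets (x \<in> L) (y \<in> L)"
    if r: "dcongruence Sets ?F r" and "x \<in> carrier ?F" "(x, y) \<notin> r" for r x y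
  proof (rule bexI)
    show "r `` {x} \<in> invariant_languages Sets \<Sigma> ?ev r" by (rule mem_dcongruence_class[OF r])
    show "\<not> dle Sets (x \<in> r `` {x}) (y \<in> r `` {x})"
      using dcongruenceD(3)[OF r that(2)] that(3) by (simp only: dle_def Image_singleton_iff) simp
  qed
  show "closed_boolean \<Sigma> (\<Union>S)" if ne: "S \<noteq> {}" and cl: "\<And>U. U \<in> S \<Longrightarrow> closed_boolean \<Sigma> U"
    and dir: "\<And>U U'. U \<in> S \<Longrightarrow> U' \<in> S \<Longrightarrow> \<exists>W\<in>S. U \<subseteq> W \<and> U' \<subseteq> W" for S
  proof -
    have two: "\<exists>W\<in>S. K \<in> W \<and> L \<in> W" if KL: "K \<in> \<Union>S" "L \<in> \<Union>S" for K L
    proof -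
      obtain U U' where "U \<in> S" "K \<in> U" "U' \<in> S" "L \<in> U'" using KL by auto
      then show ?thesis using dir[of U U'] by auto
    qed
    have "{} \<in> \<Union>S" "\<forall>L\<in>\<Union>S. lists \<Sigma> - L \<in> \<Union>S" using ne cl by blast+
    moreover have "\<forall>K\<in>\<Union>S. \<forall>L\<in>\<Union>S. K \<union> L \<in> \<Union>S" "\<forall>K\<in>\<Union>S. \<forall>L\<in>\<Union>S. K \<inter> L \<in> \<Union>S"
      using two cl by (meson UnionI)+
    ultimately show ?thesis by simp
  qed
  show "invariant_languages Sets \<Sigma> ?ev (language_rel Sets ?F ?ev \<Delta>) \<subseteq> V"
    if V: "closed_boolean \<Sigma> V" and VS: "\<forall>L\<in>V. L \<subseteq> lists \<Sigma>" and \<Delta>: "finite \<Delta>" "\<Delta> \<subseteq> V" for V \<Delta>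
  proof
    fix L assume L: "L \<in> invariant_languages Sets \<Sigma> ?ev (language_rel Sets ?F ?ev \<Delta>)"
    have LS: "L \<subseteq> lists \<Sigma>" using L by (simp add: invariant_languages_def)
    have "lists \<Sigma> - {} \<in> V" using V by blast
    show "L \<in> V"
    \<comment> \<open>Adding complements turns the one-sided comparison into equality of membership,
      which reduces the boolean case to the lattice case.\<close>
    proof (rule mem_lattice_if_upward_closed[where \<Delta> = "\<Delta> \<union> (\<lambda>K. lists \<Sigma> - K) ` \<Delta>" and \<Sigma> = \<Sigma>])
      fix x y assume xy: "x \<in> L" "y \<in> lists \<Sigma>"
        and *: "\<forall>K\<in>\<Delta> \<union> (\<lambda>K. lists \<Sigma> - K) ` \<Delta>. x \<in> K \<longrightarrow> y \<in> K"
      have "(x \<in> K) = (y \<in> K)" if "K \<in> \<Delta>" for K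
        using bspec[OF *, of K] bspec[OF *, of "lists \<Sigma> - K"] that xy LS by auto
      then have "(x, y) \<in> language_rel Sets ?F ?ev \<Delta>" using xy LS by (auto simp: language_rel_def dle_def)
      then show "y \<in> L" using L xy by (auto simp: invariant_languages_def dle_def)
    qed (use V \<Delta> LS \<open>lists \<Sigma> - {} \<in> V\<close> in auto)
  qed
qed (auto simp: dle_def left_derivative_def right_derivative_def)

lemma language_duality_Posets:
  "language_duality Posets (free_monoid \<Sigma>) \<Sigma> (\<lambda>L w. w \<in> L) (\<lambda>w. w) (closed_lattice \<Sigma>)"
proof unfold_locales
  let ?F = "free_monoid \<Sigma>" and ?ev = "\<lambda>L w. w \<in> L"
  show "dmonoid Posets ?F" by (simp add: dmonoid_free_monoid)
  show "closed_lattice \<Sigma> (invariant_languages Posets \<Sigma> ?ev r)" if r: "dcongruence Posets ?F r" for r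
    using dcongruenceD(1,2)[OF r] unfolding invariant_languages_def dle_def
    by (auto simp del: in_lists_conv_set del: in_listsI)
  show "\<exists>L\<in>invariant_languages Posets \<Sigma> ?ev r. \<not> dle Posets (x \<in> L) (y \<in> L)"
    if r: "dcongruence Posets ?F r" and "x \<in> carrier ?F" "(x, y) \<notin> r" for r x y
  proof (rule bexI)
    show "r `` {x} \<in> invariant_languages Posets \<Sigma> ?ev r" by (rule mem_dcongruence_class[OF r])
    show "\<not> dle Posets (x \<in> r `` {x}) (y \<in> r `` {x})"
      using dcongruenceD(3)[OF r that(2)] that(3) by (simp only: dle_def Image_singleton_iff) simp
  qed
  show "closed_lattice \<Sigma> (\<Union>S)" if ne: "S \<noteq> {}" and cl: "\<And>U. U \<in> S \<Longrightarrow> closed_lattice \<Sigma> U"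
    and dir: "\<And>U U'. U \<in> S \<Longrightarrow> U' \<in> S \<Longrightarrow> \<exists>W\<in>S. U \<subseteq> W \<and> U' \<subseteq> W" for S
  proof -
    have two: "\<exists>W\<in>S. K \<in> W \<and> L \<in> W" if KL: "K \<in> \<Union>S" "L \<in> \<Union>S" for K L
    proof -
      obtain U U' where "U \<in> S" "K \<in> U" "U' \<in> S" "L \<in> U'" using KL by auto
      then show ?thesis using dir[of U U'] by auto
    qed
    have "{} \<in> \<Union>S" "lists \<Sigma> \<in> \<Union>S" using ne cl by blast+
    moreover have "\<forall>K\<in>\<Union>S. \<forall>L\<in>\<Union>S. K \<union> L \<in> \<Union>S" "\<forall>K\<in>\<Union>S. \<forall>L\<in>\<Union>S. K \<inter> L \<in> \<Union>S"
      using two cl by (meson UnionI)+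
    ultimately show ?thesis by simp
  qed
  show "invariant_languages Posets \<Sigma> ?ev (language_rel Posets ?F ?ev \<Delta>) \<subseteq> V"
    if V: "closed_lattice \<Sigma> V" and VS: "\<forall>L\<in>V. L \<subseteq> lists \<Sigma>" and \<Delta>: "finite \<Delta>" "\<Delta> \<subseteq> V" for V \<Delta>
  proof
    fix L assume L: "L \<in> invariant_languages Posets \<Sigma> ?ev (language_rel Posets ?F ?ev \<Delta>)"
    have LS: "L \<subseteq> lists \<Sigma>" using L by (simp add: invariant_languages_def)
    show "L \<in> V"
    \<comment> \<open>For posets the induced relation is already one-sided, so
      \<open>\<Delta>\<close> itself serves.\<close>
    proof (rule mem_lattice_if_upward_closed[where \<Delta> = \<Delta> and \<Sigma> = \<Sigma>])
      fix x y assume xy: "x \<in> L" "y \<in> lists \<Sigma>" and *: "\<forall>K\<in>\<Delta>. x \<in> K \<longrightarrow> y \<in> K"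
      then have "(x, y) \<in> language_rel Posets ?F ?ev \<Delta>" using LS by (auto simp: language_rel_def dle_def)
      then show "y \<in> L" using L xy by (auto simp: invariant_languages_def dle_def)
    qed (use V \<Delta> LS in auto)
  qed
qed (auto simp: dle_def left_derivative_def right_derivative_def)


subsection \<open>Idempotent semirings\<close>

abbreviation (input) finite_languages :: "'a set \<Rightarrow> 'a list set set" where
  "finite_languages \<Sigma> \<equiv> {L. finite L \<and> L \<subseteq> lists \<Sigma>}"

lemma free_semiring_simps [simp]:
  "carrier (free_semiring \<Sigma>) = finite_languages \<Sigma>"
  "K \<otimes>\<^bsub>free_semiring \<Sigma>\<^esub> L = {u @ v | u v. u \<in> K \<and> v \<in> L}"
  "\<one>\<^bsub>free_semiring \<Sigma>\<^esub> = {[]}" "\<zero>\<^bsub>free_semiring \<Sigma>\<^esub> = {}" "K \<oplus>\<^bsub>free_semiring \<Sigma>\<^esub> L = K \<union> L"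
  by (simp_all add: free_semiring_def)

lemma finite_append_set: "finite K \<Longrightarrow> finite L \<Longrightarrow> finite {u @ v | u v. u \<in> K \<and> v \<in> L}"
  by (rule finite_image_set2) auto

lemma dmonoid_free_semiring: "dmonoid JoinSemilattices (free_semiring \<Sigma>)"
proof -
  let ?F = "free_semiring \<Sigma>"
  have closed: "K \<otimes>\<^bsub>?F\<^esub> L \<in> carrier ?F" if "K \<in> carrier ?F" "L \<in> carrier ?F" for K L
  proof -
    have "u @ v \<in> lists \<Sigma>" if "u \<in> K" "v \<in> L" for u v
      using that \<open>K \<in> carrier ?F\<close> \<open>L \<in> carrier ?F\<close> subsetD[of K "lists \<Sigma>" u] subsetD[of L "lists \<Sigma>" v] by simp
    then show ?thesis using that finite_append_set[of K L] by (auto simp del: in_lists_conv_set del: in_listsI)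
  qed
  have "(K \<otimes>\<^bsub>?F\<^esub> L) \<otimes>\<^bsub>?F\<^esub> M = K \<otimes>\<^bsub>?F\<^esub> (L \<otimes>\<^bsub>?F\<^esub> M)" for K L M
  proof (intro equalityI subsetI)
    fix x
    show "x \<in> K \<otimes>\<^bsub>?F\<^esub> (L \<otimes>\<^bsub>?F\<^esub> M)" if x: "x \<in> (K \<otimes>\<^bsub>?F\<^esub> L) \<otimes>\<^bsub>?F\<^esub> M"
    proof -
      obtain u v w where "u \<in> K" "v \<in> L" "w \<in> M" "x = u @ (v @ w)" using x by auto
      then show ?thesis unfolding free_semiring_simps by blast
    qed
    show "x \<in> (K \<otimes>\<^bsub>?F\<^esub> L) \<otimes>\<^bsub>?F\<^esub> M" if x: "x \<in> K \<otimes>\<^bsub>?F\<^esub> (L \<otimes>\<^bsub>?F\<^esub> M)"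
    proof -
      obtain u v w where "u \<in> K" "v \<in> L" "w \<in> M" "x = (u @ v) @ w" using x by auto
      then show ?thesis unfolding free_semiring_simps by blast
    qed
  qed
  then have mon: "Group.monoid ?F"
    using closed by (intro monoidI) simp_all
  have "abelian_monoid ?F" by (rule abelian_monoidI) auto
  moreover have "dmorphism JoinSemilattices ?F ?F (\<lambda>L. K \<otimes>\<^bsub>?F\<^esub> L)"
    "dmorphism JoinSemilattices ?F ?F (\<lambda>L. L \<otimes>\<^bsub>?F\<^esub> K)" if K: "K \<in> carrier ?F" for K
    using closed K unfolding dmorphism_def by (auto simp del: free_semiring_simps(1))
  ultimately show ?thesis using mon by (simp add: dmonoid_def)
qed

abbreviation "closed_semilattice V \<equiv> {} \<in> V \<and> (\<forall>K\<in>V. \<forall>L\<in>V. K \<union> L \<in> V)"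

text \<open>The join-preserving extension of a characteristic function to finite unions says that
  the finite set meets \<open>L\<close>.\<close>

lemma language_duality_JoinSemilattices:
  "language_duality JoinSemilattices (free_semiring \<Sigma>) \<Sigma> (\<lambda>L K. K \<inter> L \<noteq> {}) (\<lambda>w. {w}) closed_semilattice"
proof unfold_locales
  let ?D = JoinSemilattices and ?F = "free_semiring \<Sigma>" and ?ev = "\<lambda>L K. K \<inter> L \<noteq> {}"
  show "dmonoid ?D ?F" by (rule dmonoid_free_semiring)
  fix L :: "'a list set"
  show "?ev L {w} \<longleftrightarrow> w \<in> L" for w by simp
  show "?ev (left_derivative w L) x \<longleftrightarrow> ?ev L ({w} \<otimes>\<^bsub>?F\<^esub> x)" for w x
    by (auto simp: left_derivative_def)
  show "?ev (right_derivative L w) x \<longleftrightarrow> ?ev L (x \<otimes>\<^bsub>?F\<^esub> {w})" for w x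
    by (auto simp: right_derivative_def)
  have mult_left: "?ev L (z \<otimes>\<^bsub>?F\<^esub> x) \<longleftrightarrow> (\<exists>u\<in>z. ?ev (left_derivative u L) x)"
    and mult_right: "?ev L (x \<otimes>\<^bsub>?F\<^esub> z) \<longleftrightarrow> (\<exists>u\<in>z. ?ev (right_derivative L u) x)" for x z
    by (auto simp: left_derivative_def right_derivative_def)
  show "dle ?D (?ev L (z \<otimes>\<^bsub>?F\<^esub> x)) (?ev L (z \<otimes>\<^bsub>?F\<^esub> y))"
    if "z \<in> carrier ?F"
      and "\<And>u. u \<in> lists \<Sigma> \<Longrightarrow> dle ?D (?ev (left_derivative u L) x) (?ev (left_derivative u L) y)" for x y z
  proof -
    have "u \<in> lists \<Sigma>" if "u \<in> z" for u using \<open>z \<in> carrier ?F\<close> that by (auto simp del: in_lists_conv_set)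
    then show ?thesis using that(2) unfolding mult_left dle_def by simp
  qed
  show "dle ?D (?ev L (x \<otimes>\<^bsub>?F\<^esub> z)) (?ev L (y \<otimes>\<^bsub>?F\<^esub> z))"
    if "z \<in> carrier ?F"
      and "\<And>u. u \<in> lists \<Sigma> \<Longrightarrow> dle ?D (?ev (right_derivative L u) x) (?ev (right_derivative L u) y)" for x y z
  proof -
    have "u \<in> lists \<Sigma>" if "u \<in> z" for u using \<open>z \<in> carrier ?F\<close> that by (auto simp del: in_lists_conv_set)
    then show ?thesis using that(2) unfolding mult_right dle_def by simp
  qed
  show "?ev L (x \<oplus>\<^bsub>?F\<^esub> z) = ?ev L (y \<oplus>\<^bsub>?F\<^esub> z)" if "?ev L x = ?ev L y" for x y z
    using that by auto
next
  let ?D = JoinSemilattices and ?F = "free_semiring \<Sigma>" and ?ev = "\<lambda>L K. K \<inter> L \<noteq> {}"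
  show "closed_semilattice (invariant_languages ?D \<Sigma> ?ev r)" for r
    unfolding invariant_languages_def dle_def by auto
  show "closed_semilattice (\<Union>S)" if "S \<noteq> {}" "\<And>U. U \<in> S \<Longrightarrow> closed_semilattice U"
    "\<And>U U'. U \<in> S \<Longrightarrow> U' \<in> S \<Longrightarrow> \<exists>W\<in>S. U \<subseteq> W \<and> U' \<subseteq> W" for S
    using that by (intro conjI ballI) (blast, meson UnionE UnionI in_mono)
  show "invariant_languages ?D \<Sigma> ?ev (language_rel ?D ?F ?ev \<Delta>) \<subseteq> V"
    if V: "closed_semilattice V" and VS: "\<forall>L\<in>V. L \<subseteq> lists \<Sigma>" and \<Delta>: "finite \<Delta>" "\<Delta> \<subseteq> V" for V \<Delta>
  proof
    fix L assume L: "L \<in> invariant_languages ?D \<Sigma> ?ev (language_rel ?D ?F ?ev \<Delta>)"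
    have LS: "L \<subseteq> lists \<Sigma>" using L by (simp add: invariant_languages_def)
    \<comment> \<open>It suffices to write \<open>L\<close> as the finite union of those members of
      \<open>\<Delta>\<close> that it contains.\<close>
    have "L \<subseteq> \<Union>{K \<in> \<Delta>. K \<subseteq> L}"
    proof
      fix w assume w: "w \<in> L"
      show "w \<in> \<Union>{K \<in> \<Delta>. K \<subseteq> L}"
      proof (rule ccontr)
        assume neg: "w \<notin> \<Union>{K \<in> \<Delta>. K \<subseteq> L}"
        txt \<open>A finite set \<open>x\<close> of witnesses outside \<open>L\<close> makes \<open>insert w x\<close> and \<open>x\<close> indistinguishable by \<open>\<Delta>\<close>.\<close>
        define \<Delta>' where "\<Delta>' = {K \<in> \<Delta>. w \<in> K}"
        have "\<forall>K\<in>\<Delta>'. \<exists>u. u \<in> K \<and> u \<notin> L" using neg by (auto simp: \<Delta>'_def)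
        then obtain c where c: "\<And>K. K \<in> \<Delta>' \<Longrightarrow> c K \<in> K \<and> c K \<notin> L" by metis
        define x where "x = c ` \<Delta>'"
        have "x \<subseteq> lists \<Sigma>" using c VS \<Delta>(2) unfolding x_def \<Delta>'_def by blast
        moreover have "finite x" using \<Delta>(1) by (simp add: x_def \<Delta>'_def)
        moreover have "?ev K (insert w x) \<longleftrightarrow> ?ev K x" if "K \<in> \<Delta>" for K
          using c that unfolding x_def \<Delta>'_def by blast
        ultimately have "(insert w x, x) \<in> language_rel ?D ?F ?ev \<Delta>"
          using w LS by (auto simp: language_rel_def dle_def simp del: in_lists_conv_set)
        then have "?ev L (insert w x) \<longleftrightarrow> ?ev L x"
          using L by (auto simp: invariant_languages_def dle_def)
        moreover have "\<not> ?ev L x" using c by (auto simp: x_def)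
        ultimately show False using w by simp
      qed
    qed
    then have "L = \<Union>{K \<in> \<Delta>. K \<subseteq> L}" by blast
    also have "\<dots> \<in> V" using V \<Delta> by (intro Union_mem_if_finite) auto
    finally show "L \<in> V" .
  qed
  show "\<exists>L\<in>invariant_languages ?D \<Sigma> ?ev r. \<not> dle ?D (?ev L x) (?ev L y)"
    if r: "dcongruence ?D ?F r" and x: "x \<in> carrier ?F" and y: "y \<in> carrier ?F" and xy: "(x, y) \<notin> r" for r x y
  proof -
    note r' = dcongruenceD[OF r, simplified]
    \<comment> \<open>In the quotient by \<open>r\<close>, the pair
      \<open>({w} \<union> b, b)\<close> says that \<open>w\<close> lies below \<open>b\<close>. So
      \<open>L b\<close> represents the functional that is true exactly off the principal ideal of
      \<open>b\<close>.\<close>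
    define L where "L b = {w \<in> lists \<Sigma>. ({w} \<union> b, b) \<notin> r}" for b
    \<comment> \<open>In the quotient, \<open>K\<close> is the finite join of its words and lies
      below \<open>b\<close> exactly when each of them does.\<close>
    have ev: "?ev (L b) K \<longleftrightarrow> (K \<union> b, b) \<notin> r" if b: "b \<in> carrier ?F" and K: "K \<in> carrier ?F" for b K
    proof -
      have "(K \<union> b, b) \<in> r" if "\<forall>w\<in>K. ({w} \<union> b, b) \<in> r"
      proof -
        have "finite K" using K by simp
        then show ?thesis using K that
        proof (induction K)
          case empty then show ?case using b r'(3) by simp
        next
          case (insert w K)
          then have Kb: "(K \<union> b, b) \<in> r" "({w} \<union> b, b) \<in> r" by auto
          have "{w} \<in> carrier ?F" using insert.prems by simp
          then have "(K \<union> b \<union> {w}, b \<union> {w}) \<in> r" using r'(9)[OF Kb(1)] by (simp del: Un_insert_right)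
          moreover have "b \<union> {w} = {w} \<union> b" "K \<union> b \<union> {w} = insert w K \<union> b" by auto
          ultimately show ?case using r'(4)[OF _ Kb(2)] by simp
        qed
      qed
      moreover have "({w} \<union> b, b) \<in> r" if Kb: "(K \<union> b, b) \<in> r" and w: "w \<in> K" for w
      proof -
        have "{w} \<in> carrier ?F" using w K by auto
        then have "(K \<union> b \<union> {w}, b \<union> {w}) \<in> r" using r'(9)[OF Kb] by (simp del: Un_insert_right)
        moreover have "K \<union> b \<union> {w} = K \<union> b" using w by auto
        ultimately have "(K \<union> b, {w} \<union> b) \<in> r" by (simp add: Un_ac)
        then show ?thesis using r'(4,5) Kb by blast
      qed
      moreover have "K \<subseteq> lists \<Sigma>" using K by simp
      ultimately show ?thesis unfolding L_def by blast
    qed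
    have inv: "L b \<in> invariant_languages ?D \<Sigma> ?ev r" if b: "b \<in> carrier ?F" for b
    proof -
      have "?ev (L b) K = ?ev (L b) K'" if KK: "(K, K') \<in> r" for K K'
      proof -
        have K: "K \<in> carrier ?F" "K' \<in> carrier ?F" using dcongruenceD(1,2)[OF r KK] .
        have "(K \<union> b, K' \<union> b) \<in> r" using r'(9)[OF KK] b by simp
        then show ?thesis unfolding ev[OF b K(1)] ev[OF b K(2)] using r'(4,5) by meson
      qed
      then show ?thesis by (auto simp: invariant_languages_def dle_def L_def)
    qed
    \<comment> \<open>Elements below each other in the quotient coincide there, so
      \<open>L y\<close> or \<open>L x\<close> separates.\<close>
    have "(x \<union> y, y) \<notin> r \<or> (y \<union> x, x) \<notin> r"
      using xy r'(4,5) by (metis Un_commute)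
    moreover have "(x, x) \<in> r" "(y, y) \<in> r" using dcongruenceD(3)[OF r] x y by auto
    ultimately have "?ev (L y) x \<noteq> ?ev (L y) y \<or> ?ev (L x) x \<noteq> ?ev (L x) y"
      using ev x y by simp
    then show ?thesis using inv x y by (auto simp: dle_def)
  qed
qed auto


subsection \<open>Algebras over the two-element field\<close>

lemma bit_add_self [simp]: "x + x = (0::bit)"
  by (cases x) auto

lemma bit_eq_iff_one: "x = y \<longleftrightarrow> (x = 1 \<longleftrightarrow> y = (1::bit))"
  by (cases x; cases y) auto

lemma bit_add_eq_one: "x + y = 1 \<longleftrightarrow> (x = 1) \<noteq> (y = (1::bit))"
  by (cases x; cases y) auto

lemma bit_add_cancel: "(x + y) + (x + z) = y + (z::bit)"
  by (cases x; cases y; cases z) auto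

lemma of_nat_bit: "of_nat n = (of_bool (odd n) :: bit)"
  by (induction n) auto

text \<open>The sum over \<open>K \<inter> L\<close> occurs twice and cancels in characteristic
  two.\<close>

lemma sum_bit_sym_diff:
  fixes f :: "'b \<Rightarrow> bit"
  assumes "finite K" "finite L"
  shows "sum f (sym_diff K L) = sum f K + sum f L"
proof -
  have K: "sum f K = sum f (K \<inter> L) + sum f (K - L)" by (rule sum.Int_Diff[OF assms(1)])
  have L: "sum f L = sum f (K \<inter> L) + sum f (L - K)"
    using sum.Int_Diff[OF assms(2), of f K] by (simp only: Int_commute)
  have "sum f (sym_diff K L) = sum f (K - L) + sum f (L - K)"
    using assms by (intro sum.union_disjoint) auto
  then show ?thesis unfolding K L by (simp only: bit_add_cancel)
qed

lemma sum_singleton: "sum f {x} = f x"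
  by simp

text \<open>Indicators of single points are enough as tests. This turns identities between
  parity-defined products into rearrangements of finite sums.\<close>

lemma eq_if_sum_bit_eq:
  assumes "finite K" "finite L" "\<And>f :: 'b \<Rightarrow> bit. sum f K = sum f L"
  shows "K = L"
proof -
  have "w \<in> K \<longleftrightarrow> w \<in> L" for w
    using assms(3)[of "\<lambda>u. if u = w then 1 else 0"] assms(1,2) by (simp split: if_splits)
  then show ?thesis by auto
qed

section \<open>The free algebra over the two-element field\<close>

lemma free_Z2_algebra_simps [simp]:
  "carrier (free_Z2_algebra \<Sigma>) = {L. finite L \<and> L \<subseteq> lists \<Sigma>}"
  "\<one>\<^bsub>free_Z2_algebra \<Sigma>\<^esub> = {[]}" "\<zero>\<^bsub>free_Z2_algebra \<Sigma>\<^esub> = {}"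
  "K \<oplus>\<^bsub>free_Z2_algebra \<Sigma>\<^esub> L = sym_diff K L"
  "c \<odot>\<^bsub>free_Z2_algebra \<Sigma>\<^esub> L = (if c = 1 then L else {})"
  by (simp_all add: free_Z2_algebra_def)

lemma mult_free_Z2_algebra:
  "K \<otimes>\<^bsub>free_Z2_algebra \<Sigma>\<^esub> L = {w. odd (card {(u, v). u \<in> K \<and> v \<in> L \<and> w = u @ v})}"
  by (simp add: free_Z2_algebra_def)

lemma mult_free_Z2_algebra_subset:
  "K \<otimes>\<^bsub>free_Z2_algebra \<Sigma>\<^esub> L \<subseteq> (\<lambda>(u, v). u @ v) ` (K \<times> L)"
proof
  fix w assume "w \<in> K \<otimes>\<^bsub>free_Z2_algebra \<Sigma>\<^esub> L"
  then have "odd (card {(u, v). u \<in> K \<and> v \<in> L \<and> w = u @ v})" by (simp add: mult_free_Z2_algebra)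
  then have "{(u, v). u \<in> K \<and> v \<in> L \<and> w = u @ v} \<noteq> {}" by (metis card.empty even_zero)
  then show "w \<in> (\<lambda>(u, v). u @ v) ` (K \<times> L)" by auto
qed

lemma mult_free_Z2_algebra_closed:
  assumes "K \<in> carrier (free_Z2_algebra \<Sigma>)" "L \<in> carrier (free_Z2_algebra \<Sigma>)"
  shows "K \<otimes>\<^bsub>free_Z2_algebra \<Sigma>\<^esub> L \<in> carrier (free_Z2_algebra \<Sigma>)"
proof -
  have "finite ((\<lambda>(u, v). u @ v) ` (K \<times> L))" using assms by simp
  moreover have "(\<lambda>(u, v). u @ v) ` (K \<times> L) \<subseteq> lists \<Sigma>"
  proof
    fix w assume "w \<in> (\<lambda>(u, v). u @ v) ` (K \<times> L)"
    then obtain u v where "u \<in> K" "v \<in> L" "w = u @ v" by auto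
    then show "w \<in> lists \<Sigma>"
      using assms subsetD[of K "lists \<Sigma>" u] subsetD[of L "lists \<Sigma>" v] by simp
  qed
  ultimately show ?thesis
    using mult_free_Z2_algebra_subset[of \<Sigma> K L] finite_subset[of "K \<otimes>\<^bsub>free_Z2_algebra \<Sigma>\<^esub> L"]
    by (simp only: free_Z2_algebra_simps) blast
qed

text \<open>Group the pairs by their concatenation: a fibre contributes its cardinality modulo two,
  which is membership of the word in the product.\<close>

lemma sum_bit_mult:
  fixes f :: "'a list \<Rightarrow> bit"
  assumes "finite K" "finite L"
  shows "sum f (K \<otimes>\<^bsub>free_Z2_algebra \<Sigma>\<^esub> L) = (\<Sum>u\<in>K. \<Sum>v\<in>L. f (u @ v))"
proof -
  let ?c = "\<lambda>(u, v). u @ v" and ?P = "K \<otimes>\<^bsub>free_Z2_algebra \<Sigma>\<^esub> L"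
  let ?I = "?c ` (K \<times> L)"
  have fin: "finite (K \<times> L)" using assms by simp
  have set_eq: "{p \<in> K \<times> L. ?c p = w} = {(u, v). u \<in> K \<and> v \<in> L \<and> w = u @ v}" for w by auto
  have "(\<Sum>u\<in>K. \<Sum>v\<in>L. f (u @ v)) = (\<Sum>p\<in>K \<times> L. f (?c p))"
    by (simp add: sum.cartesian_product case_prod_beta)
  also have "\<dots> = (\<Sum>w\<in>?I. \<Sum>p | p \<in> K \<times> L \<and> ?c p = w. f (?c p))"
    by (rule sum.image_gen[OF fin])
  also have "\<dots> = (\<Sum>w\<in>?I. if w \<in> ?P then f w else 0)"
  proof (rule sum.cong[OF refl])
    fix w
    have "(\<Sum>p | p \<in> K \<times> L \<and> ?c p = w. f (?c p)) = (\<Sum>p | p \<in> K \<times> L \<and> ?c p = w. f w)"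
      by (intro sum.cong) auto
    also have "\<dots> = of_nat (card {p \<in> K \<times> L. ?c p = w}) * f w" by simp
    also have "\<dots> = (if w \<in> ?P then f w else 0)"
      unfolding of_nat_bit set_eq mult_free_Z2_algebra by simp
    finally show "(\<Sum>p | p \<in> K \<times> L \<and> ?c p = w. f (?c p)) = (if w \<in> ?P then f w else 0)" .
  qed
  also have "\<dots> = sum f (?I \<inter> ?P)" using fin by (simp add: sum.inter_restrict)
  also have "?I \<inter> ?P = ?P" using mult_free_Z2_algebra_subset[of \<Sigma> K L] by auto
  finally show ?thesis by simp
qed

lemma dmonoid_free_Z2_algebra: "dmonoid VectorSpacesZ2 (free_Z2_algebra \<Sigma>)"
proof -
  let ?F = "free_Z2_algebra \<Sigma>"
  note closed = mult_free_Z2_algebra_closed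
  have fin: "finite K" if "K \<in> carrier ?F" for K using that by simp
  have finm: "finite (K \<otimes>\<^bsub>?F\<^esub> L)" if "K \<in> carrier ?F" "L \<in> carrier ?F" for K L
    using closed[OF that] by simp
  have "Group.monoid ?F"
  proof (rule monoidI)
    fix K L M assume *: "K \<in> carrier ?F" "L \<in> carrier ?F" "M \<in> carrier ?F"
    \<comment> \<open>Tested against \<open>f\<close>, both sides become the same triple sum over
      \<open>K\<close>, \<open>L\<close> and \<open>M\<close>.\<close>
    show "K \<otimes>\<^bsub>?F\<^esub> L \<otimes>\<^bsub>?F\<^esub> M = K \<otimes>\<^bsub>?F\<^esub> (L \<otimes>\<^bsub>?F\<^esub> M)"
      using * by (intro eq_if_sum_bit_eq) (simp_all only: fin finm closed sum_bit_mult append_assoc)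
    show "\<one>\<^bsub>?F\<^esub> \<otimes>\<^bsub>?F\<^esub> K = K"
      using finm[OF _ *(1), of "\<one>\<^bsub>?F\<^esub>"] fin[OF *(1)]
      by (intro eq_if_sum_bit_eq) (simp_all only: sum_bit_mult free_Z2_algebra_simps finite.intros
        sum_singleton append_Nil append_Nil2 mem_Collect_eq empty_subsetI insert_subset lists.Nil simp_thms)
    show "K \<otimes>\<^bsub>?F\<^esub> \<one>\<^bsub>?F\<^esub> = K"
      using finm[OF *(1), of "\<one>\<^bsub>?F\<^esub>"] fin[OF *(1)]
      by (intro eq_if_sum_bit_eq) (simp_all only: sum_bit_mult free_Z2_algebra_simps finite.intros
        sum_singleton append_Nil append_Nil2 mem_Collect_eq empty_subsetI insert_subset lists.Nil simp_thms)
    show "K \<otimes>\<^bsub>?F\<^esub> L \<in> carrier ?F" by (rule closed) fact+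
  qed simp
  moreover have "module Z2 ?F"
  proof (rule moduleI[OF cring_Z2])
    show "abelian_group ?F" by (rule abelian_groupI) auto
  qed (use Z2_cases in \<open>auto simp: Z2_def\<close>)
  moreover have "dmorphism VectorSpacesZ2 ?F ?F (\<lambda>L. K \<otimes>\<^bsub>?F\<^esub> L) \<and>
      dmorphism VectorSpacesZ2 ?F ?F (\<lambda>L. L \<otimes>\<^bsub>?F\<^esub> K)" if K: "K \<in> carrier ?F" for K
  proof -
    have "K \<otimes>\<^bsub>?F\<^esub> sym_diff L M = sym_diff (K \<otimes>\<^bsub>?F\<^esub> L) (K \<otimes>\<^bsub>?F\<^esub> M)"
      "sym_diff L M \<otimes>\<^bsub>?F\<^esub> K = sym_diff (L \<otimes>\<^bsub>?F\<^esub> K) (M \<otimes>\<^bsub>?F\<^esub> K)"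
      if LM: "L \<in> carrier ?F" "M \<in> carrier ?F" for L M
    proof -
      have sd: "sym_diff L M \<in> carrier ?F" using LM by auto
      show "K \<otimes>\<^bsub>?F\<^esub> sym_diff L M = sym_diff (K \<otimes>\<^bsub>?F\<^esub> L) (K \<otimes>\<^bsub>?F\<^esub> M)"
        using K LM sd by (intro eq_if_sum_bit_eq)
          (simp_all only: fin finm sum_bit_mult sum_bit_sym_diff finite_Un finite_Diff sum.distrib)
      show "sym_diff L M \<otimes>\<^bsub>?F\<^esub> K = sym_diff (L \<otimes>\<^bsub>?F\<^esub> K) (M \<otimes>\<^bsub>?F\<^esub> K)"
        using K LM sd by (intro eq_if_sum_bit_eq)
          (simp_all only: fin finm sum_bit_mult sum_bit_sym_diff finite_Un finite_Diff sum.distrib)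
    qed
    moreover have "K \<otimes>\<^bsub>?F\<^esub> {} = {}" "{} \<otimes>\<^bsub>?F\<^esub> K = {}"
      using mult_free_Z2_algebra_subset[of \<Sigma> K "{}"] mult_free_Z2_algebra_subset[of \<Sigma> "{}" K] by auto
    ultimately show ?thesis
      using closed K unfolding dmorphism_def by (auto simp del: free_Z2_algebra_simps(1))
  qed
  ultimately show ?thesis by (simp add: dmonoid_def)
qed

section \<open>Languages as linear functionals\<close>

abbreviation "closed_linear V \<equiv> {} \<in> V \<and> (\<forall>K\<in>V. \<forall>L\<in>V. sym_diff K L \<in> V)"

text \<open>For finite \<open>K\<close> this is the parity of \<open>K \<inter> L\<close>, written
  as a sum over the field so that linearity is linearity of sums.\<close>

definition odd_intersection :: "'a list set \<Rightarrow> 'a list set \<Rightarrow> bool" where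
  "odd_intersection L K \<longleftrightarrow> (\<Sum>w\<in>K. if w \<in> L then 1 else 0) = (1::bit)"

lemma odd_intersection_empty [simp]: "\<not> odd_intersection L {}" "\<not> odd_intersection {} K"
  by (simp_all add: odd_intersection_def)

lemma odd_intersection_singleton [simp]: "odd_intersection L {w} \<longleftrightarrow> w \<in> L"
  by (simp add: odd_intersection_def)

lemma odd_intersection_sym_diff:
  assumes "finite K" "finite K'"
  shows "odd_intersection L (sym_diff K K') \<longleftrightarrow> odd_intersection L K \<noteq> odd_intersection L K'"
  using assms by (simp only: odd_intersection_def sum_bit_sym_diff bit_add_eq_one)

lemma odd_intersection_sym_diff_left:
  "odd_intersection (sym_diff L L') K \<longleftrightarrow> odd_intersection L K \<noteq> odd_intersection L' K"
proof -
  have "(if w \<in> sym_diff L L' then 1 else 0) =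
      (if w \<in> L then 1 else 0) + (if w \<in> L' then 1 else (0::bit))" for w
    by auto
  then show ?thesis by (simp only: odd_intersection_def sum.distrib bit_add_eq_one)
qed

text \<open>A maximal subspace among those that contain the kernel and avoid \<open>a = x - y\<close> has index two, so
  membership in its complement is a linear functional separating \<open>x\<close> from \<open>y\<close>.\<close>

lemma separating_language:
  assumes r: "dcongruence VectorSpacesZ2 (free_Z2_algebra \<Sigma>) r"
    and x: "x \<in> carrier (free_Z2_algebra \<Sigma>)" and y: "y \<in> carrier (free_Z2_algebra \<Sigma>)" and xy: "(x, y) \<notin> r"
  shows "\<exists>L\<in>invariant_languages VectorSpacesZ2 \<Sigma> odd_intersection r.
    odd_intersection L x \<noteq> odd_intersection L y"
proof -
  let ?F = "free_Z2_algebra \<Sigma>"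
  let ?C = "carrier ?F"
  note r' = dcongruenceD[OF r]
  have C: "sym_diff K L \<in> ?C" "finite K" if "K \<in> ?C" "L \<in> ?C" for K L using that by auto
  \<comment> \<open>The class of zero, which determines \<open>r\<close> by translation.\<close>
  define N where "N = {z. (z, {}) \<in> r}"
  have N_iff: "sym_diff K L \<in> N \<longleftrightarrow> (K, L) \<in> r" if KL: "K \<in> ?C" "L \<in> ?C" for K L
  proof -
    have "sym_diff (sym_diff K L) L = K" "sym_diff {} L = L" "sym_diff L L = {}" by auto
    then show ?thesis
      using r'(9)[of "sym_diff K L" "{}" L] r'(9)[of K L L] KL by (auto simp: N_def)
  qed
  define a where "a = sym_diff x y"
  have a: "a \<in> ?C" "a \<notin> N" using C(1)[OF x y] N_iff[OF x y] xy by (simp_all add: a_def)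
  \<comment> \<open>Each such \<open>U\<close> is a subspace: it contains zero through
    \<open>N\<close>, and with scalars 0 and 1 closure under sums is enough.\<close>
  define \<A> where "\<A> = {U. N \<subseteq> U \<and> U \<subseteq> ?C \<and> a \<notin> U \<and> (\<forall>u\<in>U. \<forall>v\<in>U. sym_diff u v \<in> U)}"
  have N: "N \<in> \<A>"
  proof -
    have "sym_diff u v \<in> N" if "u \<in> N" "v \<in> N" for u v
    proof -
      have uv: "(u, {}) \<in> r" "(v, {}) \<in> r" using that by (simp_all add: N_def)
      then have "(u, v) \<in> r" using r'(4,5) by blast
      then show ?thesis using N_iff r'(1) uv by blast
    qed
    then show ?thesis using a r'(1) by (auto simp: \<A>_def N_def simp del: free_Z2_algebra_simps)
  qed
  obtain U where U: "U \<in> \<A>" and max: "\<And>X. X \<in> \<A> \<Longrightarrow> U \<subseteq> X \<Longrightarrow> X = U"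
  proof -
    have "\<Union>\<C> \<in> \<A>" if "\<C> \<noteq> {}" "subset.chain \<A> \<C>" for \<C>
    proof -
      have sub: "\<C> \<subseteq> \<A>" and lin: "\<And>X Y. X \<in> \<C> \<Longrightarrow> Y \<in> \<C> \<Longrightarrow> X \<subseteq> Y \<or> Y \<subseteq> X"
        using that(2) by (auto simp: subset_chain_def)
      have "sym_diff u v \<in> \<Union>\<C>" if "u \<in> \<Union>\<C>" "v \<in> \<Union>\<C>" for u v
      proof -
        obtain X Y where "X \<in> \<C>" "Y \<in> \<C>" "u \<in> X" "v \<in> Y" using \<open>u \<in> \<Union>\<C>\<close> \<open>v \<in> \<Union>\<C>\<close> by auto
        then obtain Z where "Z \<in> \<C>" "u \<in> Z" "v \<in> Z" using lin by blast
        then have "sym_diff u v \<in> Z" using sub unfolding \<A>_def by blast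
        then show ?thesis using \<open>Z \<in> \<C>\<close> by auto
      qed
      moreover have "N \<subseteq> \<Union>\<C>" "\<Union>\<C> \<subseteq> ?C" "a \<notin> \<Union>\<C>"
        using sub \<open>\<C> \<noteq> {}\<close> unfolding \<A>_def by blast+
      ultimately show ?thesis by (simp add: \<A>_def)
    qed
    then have "\<exists>M\<in>\<A>. \<forall>X\<in>\<A>. M \<subseteq> X \<longrightarrow> X = M" using subset_Zorn_nonempty[of \<A>] N by blast
    then show thesis using that by blast
  qed
  have UC: "U \<subseteq> ?C" and aU: "a \<notin> U" and NU: "N \<subseteq> U" and Usd: "\<And>u v. u \<in> U \<Longrightarrow> v \<in> U \<Longrightarrow> sym_diff u v \<in> U"
    using U by (auto simp: \<A>_def simp del: free_Z2_algebra_simps)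
  have e: "{} \<in> U" using NU r'(3)[of "{}"] by (auto simp: N_def)
  \<comment> \<open>Index two: the span \<open>X\<close> of \<open>U\<close> and \<open>b\<close> is
    strictly larger than \<open>U\<close>, so by maximality it contains \<open>a\<close>, and then
    \<open>a\<close> and \<open>b\<close> differ by an element of \<open>U\<close>.\<close>
  have outside: "sym_diff a b \<in> U" if b: "b \<in> ?C" "b \<notin> U" for b
  proof -
    define X where "X = {t \<in> ?C. t \<in> U \<or> sym_diff b t \<in> U}"
    have eqs: "sym_diff b b = {}" "sym_diff (sym_diff b s) t = sym_diff b (sym_diff s t)"
      "sym_diff s (sym_diff b t) = sym_diff b (sym_diff s t)"
      "sym_diff (sym_diff b s) (sym_diff b t) = sym_diff s t" for s t :: "'a list set" by blast+
    have "b \<in> X" using e b by (simp add: X_def del: free_Z2_algebra_simps)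
    moreover have UX: "U \<subseteq> X" using UC by (auto simp: X_def simp del: free_Z2_algebra_simps)
    ultimately have "X \<notin> \<A>" using max[of X] b by blast
    moreover have "sym_diff u v \<in> X" if uv: "u \<in> X" "v \<in> X" for u v
    proof -
      have uvC: "u \<in> ?C" "v \<in> ?C" and cases: "u \<in> U \<or> sym_diff b u \<in> U" "v \<in> U \<or> sym_diff b v \<in> U"
        using uv by (simp_all add: X_def del: free_Z2_algebra_simps)
      have "sym_diff u v \<in> U \<or> sym_diff b (sym_diff u v) \<in> U"
        using cases Usd[of u v] Usd[of u "sym_diff b v", unfolded eqs(3)]
          Usd[of "sym_diff b u" v, unfolded eqs(2)] Usd[of "sym_diff b u" "sym_diff b v", unfolded eqs(4)]
        by argo
      then show ?thesis using C(1)[OF uvC] unfolding X_def by blast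
    qed
    moreover have "N \<subseteq> X" "X \<subseteq> ?C" using NU UX unfolding X_def by blast+
    ultimately have "a \<in> X" unfolding \<A>_def by blast
    then have "sym_diff b a \<in> U" using aU unfolding X_def by blast
    then show ?thesis by (simp add: Un_commute)
  qed
  \<comment> \<open>Non-membership in \<open>U\<close> is additive: two outside elements have their
    sum inside, as it equals the sum of their differences from \<open>a\<close>.\<close>
  have index: "sym_diff b c \<notin> U \<longleftrightarrow> (b \<notin> U) \<noteq> (c \<notin> U)" if bc: "b \<in> ?C" "c \<in> ?C" for b c
  proof -
    have *: "sym_diff (sym_diff b c) c = b" "sym_diff b (sym_diff b c) = c"
      "sym_diff (sym_diff a b) (sym_diff a c) = sym_diff b c" by blast+
    show ?thesis
      using Usd[of "sym_diff b c" c] Usd[of b "sym_diff b c"] Usd[of b c]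
        Usd[of "sym_diff a b" "sym_diff a c"] outside bc unfolding * by blast
  qed
  \<comment> \<open>A linear functional is determined by its values on single words.\<close>
  define L where "L = {w \<in> lists \<Sigma>. {w} \<notin> U}"
  have ev: "odd_intersection L K \<longleftrightarrow> K \<notin> U" if K: "K \<in> ?C" for K
  proof -
    have "finite K" "K \<subseteq> lists \<Sigma>" using K by auto
    then show ?thesis
    proof (induction K)
      case empty then show ?case using e by simp
    next
      case (insert w K)
      have eq: "insert w K = sym_diff {w} K" using insert.hyps by auto
      have c: "{w} \<in> ?C" "K \<in> ?C" using insert by auto
      have "odd_intersection L (insert w K) \<longleftrightarrow> (w \<in> L) \<noteq> odd_intersection L K"
        unfolding eq using insert.hyps by (simp only: odd_intersection_sym_diff odd_intersection_singleton finite.intros)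
      also have "\<dots> \<longleftrightarrow> ({w} \<notin> U) \<noteq> (K \<notin> U)" using insert by (auto simp: L_def)
      also have "\<dots> \<longleftrightarrow> insert w K \<notin> U" unfolding eq using index[OF c] by simp
      finally show ?case .
    qed
  qed
  have "odd_intersection L K = odd_intersection L K'" if KK: "(K, K') \<in> r" for K K'
  proof -
    have c: "K \<in> ?C" "K' \<in> ?C" using r'(1,2) KK by blast+
    then have "sym_diff K K' \<in> U" using N_iff[OF c] KK NU by blast
    then show ?thesis using index[OF c] ev c by simp
  qed
  then have "L \<in> invariant_languages VectorSpacesZ2 \<Sigma> odd_intersection r"
    by (auto simp: invariant_languages_def dle_def L_def)
  moreover have "odd_intersection L x \<noteq> odd_intersection L y"
    using index[OF x y] ev x y aU by (simp add: a_def)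
  ultimately show ?thesis by blast
qed

text \<open>The fact that a functional vanishing on the common kernel of finitely many functionals
  lies in their span. In the induction, if \<open>L\<close> does not vanish on the common kernel
  \<open>Z\<close> of the remaining ones, then \<open>L\<close> and \<open>K\<close> agree on
  \<open>Z\<close>, and \<open>sym_diff L K\<close> falls under the induction hypothesis.\<close>

lemma mem_linear_if_common_kernel:
  assumes "closed_linear V" and V: "\<forall>L\<in>V. L \<subseteq> lists \<Sigma>" and "finite \<Delta>" "\<Delta> \<subseteq> V" "L \<subseteq> lists \<Sigma>"
    and "\<And>x. x \<in> carrier (free_Z2_algebra \<Sigma>) \<Longrightarrow> \<forall>K\<in>\<Delta>. \<not> odd_intersection K x \<Longrightarrow> \<not> odd_intersection L x"
  shows "L \<in> V"
  using assms(3-6)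
proof (induction \<Delta> arbitrary: L)
  case empty
  have "w \<notin> L" if "w \<in> lists \<Sigma>" for w using empty(3)[of "{w}"] that by simp
  then have "L = {}" using empty(2) by (auto simp del: in_lists_conv_set)
  then show ?case using assms(1) by simp
next
  case (insert K \<Delta>)
  let ?C = "carrier (free_Z2_algebra \<Sigma>)"
  define Z where "Z = {x \<in> ?C. \<forall>M\<in>\<Delta>. \<not> odd_intersection M x}"
  show ?case
  proof (cases "\<forall>x\<in>Z. \<not> odd_intersection L x")
    case True
    then show ?thesis using insert.IH[of L] insert.prems by (auto simp: Z_def simp del: free_Z2_algebra_simps)
  next
    case False
    then obtain z where z: "z \<in> Z" "odd_intersection L z" by blast
    have Kz: "odd_intersection K z" using insert.prems(3)[of z] z by (auto simp: Z_def)
    have K: "K \<in> V" "K \<subseteq> lists \<Sigma>" using insert.prems V by auto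
    have "sym_diff L K \<in> V"
    proof (rule insert.IH)
      fix x assume x: "x \<in> ?C" "\<forall>M\<in>\<Delta>. \<not> odd_intersection M x"
      have fin: "finite x" "finite z" using x z by (auto simp: Z_def)
      show "\<not> odd_intersection (sym_diff L K) x"
      proof (cases "odd_intersection K x")
        case False
        then show ?thesis using insert.prems(3)[OF x(1)] x(2) by (simp add: odd_intersection_sym_diff_left)
      next
        case True
        \<comment> \<open>Adding \<open>z\<close> moves \<open>x\<close> into the kernel of
          \<open>K\<close> without leaving \<open>Z\<close>; there \<open>L\<close> vanishes, so
          \<open>L\<close> is true at \<open>x\<close> because it is at \<open>z\<close>.\<close>
        have "sym_diff x z \<in> ?C" using x z by (auto simp: Z_def)
        moreover have "\<forall>M\<in>insert K \<Delta>. \<not> odd_intersection M (sym_diff x z)"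
          unfolding odd_intersection_sym_diff[OF fin] using True Kz x(2) z(1) by (auto simp: Z_def)
        ultimately have "\<not> odd_intersection L (sym_diff x z)" using insert.prems(3) by blast
        then show ?thesis
          using True z(2) unfolding odd_intersection_sym_diff[OF fin] odd_intersection_sym_diff_left by blast
      qed
    qed (use insert.prems K in auto)
    moreover have "sym_diff (sym_diff L K) K = L" by auto
    ultimately show ?thesis using assms(1) K(1) by metis
  qed
qed

lemma language_duality_VectorSpacesZ2:
  "language_duality VectorSpacesZ2 (free_Z2_algebra \<Sigma>) \<Sigma> odd_intersection (\<lambda>w. {w}) closed_linear"
proof unfold_locales
  let ?D = VectorSpacesZ2 and ?F = "free_Z2_algebra \<Sigma>" and ?ev = odd_intersection
  show "dmonoid ?D ?F" by (rule dmonoid_free_Z2_algebra)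
  have fin: "finite K" "u \<in> K \<Longrightarrow> u \<in> lists \<Sigma>" if "K \<in> carrier ?F" for K u
    using that by (auto simp del: in_lists_conv_set)
  have sum_eq: "(\<Sum>w\<in>K. if w \<in> L then 1 else 0) = (\<Sum>w\<in>K'. if w \<in> L' then 1 else (0::bit)) \<longleftrightarrow>
      ?ev L K = ?ev L' K'" for L L' K K' :: "'a list set"
    unfolding odd_intersection_def by (rule bit_eq_iff_one)
  \<comment> \<open>Evaluation on a product is a double sum; summing first over either factor
    expresses it through left or right derivatives.\<close>
  have mult_left: "?ev L (K \<otimes>\<^bsub>?F\<^esub> K') \<longleftrightarrow>
      (\<Sum>u\<in>K. \<Sum>v\<in>K'. if v \<in> left_derivative u L then 1 else 0) = (1::bit)"
    and mult_right: "?ev L (K \<otimes>\<^bsub>?F\<^esub> K') \<longleftrightarrow>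
      (\<Sum>v\<in>K'. \<Sum>u\<in>K. if u \<in> right_derivative L v then 1 else 0) = (1::bit)"
    if "finite K" "finite K'" for L K K'
    unfolding odd_intersection_def sum_bit_mult[OF that]
    by (simp_all add: left_derivative_def right_derivative_def sum.swap[of _ K' K])
  fix L :: "'a list set"
  show "?ev (left_derivative w L) x \<longleftrightarrow> ?ev L ({w} \<otimes>\<^bsub>?F\<^esub> x)" if "x \<in> carrier ?F" for w x
    using mult_left[of "{w}" x L] fin(1)[OF that] by (simp add: odd_intersection_def)
  show "?ev (right_derivative L w) x \<longleftrightarrow> ?ev L (x \<otimes>\<^bsub>?F\<^esub> {w})" if "x \<in> carrier ?F" for w x
    using mult_right[of x "{w}" L] fin(1)[OF that] by (simp add: odd_intersection_def)
  fix x y z assume x: "x \<in> carrier ?F" and y: "y \<in> carrier ?F" and z: "z \<in> carrier ?F"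
  show "dle ?D (?ev L (z \<otimes>\<^bsub>?F\<^esub> x)) (?ev L (z \<otimes>\<^bsub>?F\<^esub> y))"
    if "\<And>u. u \<in> lists \<Sigma> \<Longrightarrow> dle ?D (?ev (left_derivative u L) x) (?ev (left_derivative u L) y)"
  proof -
    have "(\<Sum>u\<in>z. \<Sum>v\<in>x. if v \<in> left_derivative u L then 1 else 0) =
        (\<Sum>u\<in>z. \<Sum>v\<in>y. if v \<in> left_derivative u L then 1 else (0::bit))"
      by (rule sum.cong[OF refl]) (use that fin(2)[OF z] in \<open>simp add: sum_eq dle_def\<close>)
    then show ?thesis using fin(1)[OF x] fin(1)[OF y] fin(1)[OF z] by (simp add: mult_left dle_def)
  qed
  show "dle ?D (?ev L (x \<otimes>\<^bsub>?F\<^esub> z)) (?ev L (y \<otimes>\<^bsub>?F\<^esub> z))"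
    if "\<And>u. u \<in> lists \<Sigma> \<Longrightarrow> dle ?D (?ev (right_derivative L u) x) (?ev (right_derivative L u) y)"
  proof -
    have "(\<Sum>v\<in>z. \<Sum>u\<in>x. if u \<in> right_derivative L v then 1 else 0) =
        (\<Sum>v\<in>z. \<Sum>u\<in>y. if u \<in> right_derivative L v then 1 else (0::bit))"
      by (rule sum.cong[OF refl]) (use that fin(2)[OF z] in \<open>simp add: sum_eq dle_def\<close>)
    then show ?thesis using fin(1)[OF x] fin(1)[OF y] fin(1)[OF z] by (simp add: mult_right dle_def)
  qed
  show "?ev L (x \<oplus>\<^bsub>?F\<^esub> z) = ?ev L (y \<oplus>\<^bsub>?F\<^esub> z)" if "?ev L x = ?ev L y"
    using fin(1)[OF x] fin(1)[OF y] fin(1)[OF z] that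
    by (simp only: free_Z2_algebra_simps odd_intersection_sym_diff)
next
  let ?D = VectorSpacesZ2 and ?F = "free_Z2_algebra \<Sigma>" and ?ev = odd_intersection
  show "closed_linear (invariant_languages ?D \<Sigma> ?ev r)" for r
    unfolding invariant_languages_def dle_def by (auto simp only: odd_intersection_sym_diff_left) auto
  show "closed_linear (\<Union>S)" if ne: "S \<noteq> {}" and cl: "\<And>U. U \<in> S \<Longrightarrow> closed_linear U"
    and dir: "\<And>U U'. U \<in> S \<Longrightarrow> U' \<in> S \<Longrightarrow> \<exists>W\<in>S. U \<subseteq> W \<and> U' \<subseteq> W" for S :: "'a list set set set"
  proof -
    have "sym_diff K L \<in> \<Union>S" if KL: "K \<in> \<Union>S" "L \<in> \<Union>S" for K L
    proof -
      obtain U U' where U: "U \<in> S" "K \<in> U" "U' \<in> S" "L \<in> U'" using KL by auto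
      then obtain W where "W \<in> S" "K \<in> W" "L \<in> W" using dir[of U U'] by auto
      then show ?thesis using cl[of W] by blast
    qed
    moreover have "{} \<in> \<Union>S" using ne cl by blast
    ultimately show ?thesis by blast
  qed
  show "invariant_languages ?D \<Sigma> ?ev (language_rel ?D ?F ?ev \<Delta>) \<subseteq> V"
    if V: "closed_linear V" and VS: "\<forall>L\<in>V. L \<subseteq> lists \<Sigma>" and \<Delta>: "finite \<Delta>" "\<Delta> \<subseteq> V" for V \<Delta>
  proof
    fix L assume L: "L \<in> invariant_languages ?D \<Sigma> ?ev (language_rel ?D ?F ?ev \<Delta>)"
    show "L \<in> V"
    proof (rule mem_linear_if_common_kernel[OF V VS \<Delta>])
      show "L \<subseteq> lists \<Sigma>" using L by (simp add: invariant_languages_def)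
      fix x assume "x \<in> carrier ?F" "\<forall>K\<in>\<Delta>. \<not> ?ev K x"
      \<comment> \<open>Lying in the common kernel means being indistinguishable from zero by
        \<open>\<Delta>\<close>, and then \<open>L\<close> cannot tell \<open>x\<close> from zero
        either.\<close>
      then have "(x, {}) \<in> language_rel ?D ?F ?ev \<Delta>" by (simp add: language_rel_def dle_def)
      then have "?ev L x = ?ev L {}" using L by (auto simp: invariant_languages_def dle_def)
      then show "\<not> ?ev L x" by simp
    qed
  qed
  show "\<exists>L\<in>invariant_languages ?D \<Sigma> ?ev r. \<not> dle ?D (?ev L x) (?ev L y)"
    if "dcongruence ?D ?F r" "x \<in> carrier ?F" "y \<in> carrier ?F" "(x, y) \<notin> r" for r x y
    using separating_language[OF that] by (simp add: dle_def)
qed auto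

subsection \<open>The four correspondences\<close>

theorem corollary4p37:
  fixes \<Sigma> :: "'a set"
  assumes "finite \<Sigma>"
  shows
    "(\<exists>f. lattice_isomorphism
        (inclusion_order (local_variety \<Sigma>))
        (inclusion_order (local_pseudovariety Sets (free_monoid \<Sigma>))) f) \<and>
     (\<exists>f. lattice_isomorphism
        (inclusion_order (local_lattice_variety \<Sigma>))
        (inclusion_order (local_pseudovariety Posets (free_monoid \<Sigma>))) f) \<and>
     (\<exists>f. lattice_isomorphism
        (inclusion_order (local_semilattice_variety \<Sigma>))
        (inclusion_order (local_pseudovariety JoinSemilattices (free_semiring \<Sigma>))) f) \<and>
     (\<exists>f. lattice_isomorphism
        (inclusion_order (local_linear_variety \<Sigma>))
        (inclusion_order (local_pseudovariety VectorSpacesZ2 (free_Z2_algebra \<Sigma>))) f)"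
proof (intro conjI)
  show "\<exists>f. lattice_isomorphism (inclusion_order (local_variety \<Sigma>))
      (inclusion_order (local_pseudovariety Sets (free_monoid \<Sigma>))) f"
    by (rule language_duality.ex_lattice_isomorphism[OF language_duality_Sets])
      (auto simp: local_variety_def)
  show "\<exists>f. lattice_isomorphism (inclusion_order (local_lattice_variety \<Sigma>))
      (inclusion_order (local_pseudovariety Posets (free_monoid \<Sigma>))) f"
    by (rule language_duality.ex_lattice_isomorphism[OF language_duality_Posets])
      (auto simp: local_lattice_variety_def)
  show "\<exists>f. lattice_isomorphism (inclusion_order (local_semilattice_variety \<Sigma>))
      (inclusion_order (local_pseudovariety JoinSemilattices (free_semiring \<Sigma>))) f"
    by (rule language_duality.ex_lattice_isomorphism[OF language_duality_JoinSemilattices])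
      (auto simp: local_semilattice_variety_def)
  show "\<exists>f. lattice_isomorphism (inclusion_order (local_linear_variety \<Sigma>))
      (inclusion_order (local_pseudovariety VectorSpacesZ2 (free_Z2_algebra \<Sigma>))) f"
    by (rule language_duality.ex_lattice_isomorphism[OF language_duality_VectorSpacesZ2])
      (auto simp: local_linear_variety_def)
qed

end
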